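(* In the regression model $y_k=S(x_k)+g(x_k,S)\xi_k$, $k=1,\dots,n$, $x_k=k/n$, with $\xi_1,\dots,\xi_n$ i.i.d. having an unknown density $p\in\mathcal P_{\varepsilon,L}$, under the standing assumptions (A1)–(A3) on $g$ listed in the context, the kernel estimator $$\hat S_n(z_0)=\frac1{q_n}\sum_{k=1}^nQ\Big(\frac{x_k-z_0}{h}\Big)y_k$$ satisfies $$\limsup_{\delta\to0}\ \limsup_{n\to\infty}\ \tilde{\mathcal R}_{z_0,\delta}(\hat S_n(z_0))\ \le\ \frac{\mathbb E|\eta|}{\sqrt2},\qquad \eta\sim\mathcal N(0,1).$$
   Context: Setting. Fix $z_0\in(0,1)$ and $\beta=1+\alpha$ with $\alpha\in(0,1]$. $C^1([0,1],\mathbb R)$ is the space of continuously differentiable functions on $[0,1]$, and $\|f\|=\sup_{x\in[0,1]}|f(x)|$. The function $g:[0,1]\times C^1([0,1],\mathbb R)\to(0,\infty)$ is a scale functional, and $S$ is the unknown regression function. Classes. For $M,K>0$, $$\mathcal H(M,K,\beta)=\Big\{S\in C^1([0,1],\mathbb R):\ \|S'\|\le M,\ \sup_{x,y\in[0,1],\,x\ne y}\frac{|S'(y)-S'(x)|}{|x-y|^{\alpha}}\le K\Big\},\qquad \mathcal H(\beta)=\bigcup_{M>0,K>0}\mathcal H(M,K,\beta).$$ For $0<\delta<1$, $$\mathcal U_{z_0,\delta}=\Big\{S\in\mathcal H(\beta):\ \|S'\|\le\delta^{-1},\ \Big|\int_{-1}^1\big(S(z_0+tu)-S(z_0)\big)du\Big|\le\delta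 t^{\beta}\ \text{ for all } t>0 \text{ with } [z_0-t,z_0+t]\subset[0,1]\Big\}.$$ Noise densities. For fixed $\varepsilon>0$ and $L>0$, $\mathcal P_{\varepsilon,L}$ is the set of probability densities $p$ on $\mathbb R$ with $\int xp(x)dx=0$, $\int x^2p(x)dx=1$, $\int|x|^{2+\varepsilon}p(x)dx\le L$; $L$ is taken large enough that the standard Gaussian density belongs to $\mathcal P_{\varepsilon,L}$. Notation. $\varphi_n=n^{\beta/(2\beta+1)}$, $h=n^{-1/(2\beta+1)}$, $Q=\mathbb I_{[-1,1]}$ (indicator function), $x_k=k/n$, $q_n=\sum_{k=1}^nQ\big(\frac{x_k-z_0}{h}\big)$. Standing assumptions on $g$. (A1) For every $\delta\in(0,1)$, $$\lim_{n\to\infty}\ \sup_{S\in\mathcal U_{z_0,\delta}}\left|\Big(\frac1{q_n}\sum_{k=1}^nQ\Big(\frac{x_k-z_0}{h}\Big)g^2(x_k,S)\Big)^{1/2}-g(z_0,S)\right|=0.$$ (A2) There are $g_\star>0$ and $g^\star<\infty$ with $g_\star\le g(x,S)\le g^\star$ for all $x\in[0,1]$ and $S\in C^1([0,1],\mathbb R)$. (A3) For all $S,S_0\in C^1([0,1],\mathbb R)$ and $x\in[0,1]$, $g(x,S)=g(x,S_0)+L_{x,S_0}(S-S_0)+\Gamma_{x,S_0}(S-S_0)$, where $L_{x,S_0}$ is a linear functional on $C^1([0,1],\mathbb R)$ for which there is a constant $C_{S_0}>0$ with $\sup_{x\in[0,1]}\sup_{S\in C^1([0,1],\mathbb R),\,\|S\|\ne0}|L_{x,S_0}(S)|/\|S\|\le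 C_{S_0}$, and $\lim_{\|S\|\to0}\sup_{x\in[0,1]}|\Gamma_{x,S_0}(S)|/\|S\|=0$. Risk. For an estimator $\tilde S$ of $S(z_0)$ (a measurable real-valued function of $(y_1,\dots,y_n)$), $$\tilde{\mathcal R}_{z_0,\delta}(\tilde S)=\sup_{p\in\mathcal P_{\varepsilon,L}}\ \sup_{S\in\mathcal U_{z_0,\delta}}\mathbb E_S\Big[\varphi_n\frac{|\tilde S-S(z_0)|}{g(z_0,S)}\Big],$$ where $\mathbb E_S$ is the expectation under the law of $(y_1,\dots,y_n)$ when the regression function is $S$ and the noise density is $p$. *)

theory Defs
  imports "HOL-Probability.Probability"
begin

text \<open>
  An element of \<open>C\<^sup>1([0,1],\<real>)\<close> is represented by its extension by 0 to the real line, so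
  that a function on \<open>[0,1]\<close> has exactly one representative and the representatives are closed under
  pointwise linear combinations. Derivatives are taken within \<open>[0,1]\<close> (one-sided at the end points)
  and do not see this extension.
\<close>

definition deriv01 :: "(real \<Rightarrow> real) \<Rightarrow> real \<Rightarrow> real" where
  "deriv01 S x = vector_derivative S (at x within {0..1})"

definition C1 :: "(real \<Rightarrow> real) set" where
  "C1 = {S. (\<forall>x. x \<notin> {0..1} \<longrightarrow> S x = 0)
          \<and> (\<forall>x\<in>{0..1}. S differentiable (at x within {0..1}))
          \<and> continuous_on {0..1} (deriv01 S)}"

text \<open>Only applied to functions that are bounded on \<open>[0,1]\<close>, where the real supremum is the right one.\<close>

definition supnorm :: "(real \<Rightarrow> real) \<Rightarrow> real" where
  "supnorm f = (SUP x\<in>{0..1}. \<bar>f x\<bar>)"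

text \<open>The Hoelder exponent of the derivative is \<open>\<alpha> = \<beta> - 1\<close>.\<close>

definition holder_ball :: "real \<Rightarrow> real \<Rightarrow> real \<Rightarrow> (real \<Rightarrow> real) set" where
  "holder_ball M K \<beta> = {S \<in> C1. supnorm (deriv01 S) \<le> M
      \<and> (\<forall>x\<in>{0..1}. \<forall>y\<in>{0..1}. x \<noteq> y \<longrightarrow>
            \<bar>deriv01 S y - deriv01 S x\<bar> / \<bar>x - y\<bar> powr (\<beta> - 1) \<le> K)}"

definition holder_class :: "real \<Rightarrow> (real \<Rightarrow> real) set" where
  "holder_class \<beta> = (\<Union>M\<in>{0<..}. \<Union>K\<in>{0<..}. holder_ball M K \<beta>)"

definition weak_holder :: "real \<Rightarrow> real \<Rightarrow> real \<Rightarrow> (real \<Rightarrow> real) set" where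
  "weak_holder \<beta> z0 \<delta> = {S \<in> holder_class \<beta>. supnorm (deriv01 S) \<le> inverse \<delta>
      \<and> (\<forall>t>0. {z0 - t..z0 + t} \<subseteq> {0..1} \<longrightarrow>
            \<bar>LINT u:{-1..1}|lborel. S (z0 + t * u) - S z0\<bar> \<le> \<delta> * t powr \<beta>)}"

definition noise_densities :: "real \<Rightarrow> real \<Rightarrow> (real \<Rightarrow> real) set" where
  "noise_densities \<epsilon> L = {p. p \<in> borel_measurable borel \<and> (\<forall>x. 0 \<le> p x)
      \<and> prob_space (density lborel p)
      \<and> has_bochner_integral lborel (\<lambda>x. x * p x) 0
      \<and> has_bochner_integral lborel (\<lambda>x. x\<^sup>2 * p x) 1
      \<and> (\<integral>\<^sup>+x. ennreal (\<bar>x\<bar> powr (2 + \<epsilon>) * p x) \<partial>lborel) \<le> ennreal L}"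

definition design :: "nat \<Rightarrow> nat \<Rightarrow> real" where
  "design n k = real k / real n"

definition rate :: "real \<Rightarrow> nat \<Rightarrow> real" where
  "rate \<beta> n = real n powr (\<beta> / (2 * \<beta> + 1))"

definition bandwidth :: "real \<Rightarrow> nat \<Rightarrow> real" where
  "bandwidth \<beta> n = real n powr (- 1 / (2 * \<beta> + 1))"

definition kern :: "real \<Rightarrow> real" where
  "kern = indicat_real {-1..1}"

definition weight :: "real \<Rightarrow> real \<Rightarrow> nat \<Rightarrow> nat \<Rightarrow> real" where
  "weight \<beta> z0 n k = kern ((design n k - z0) / bandwidth \<beta> n)"

definition qn :: "real \<Rightarrow> real \<Rightarrow> nat \<Rightarrow> real" where
  "qn \<beta> z0 n = (\<Sum>k=1..n. weight \<beta> z0 n k)"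

definition kernel_estimator :: "real \<Rightarrow> real \<Rightarrow> nat \<Rightarrow> (nat \<Rightarrow> real) \<Rightarrow> real" where
  "kernel_estimator \<beta> z0 n y = 1 / qn \<beta> z0 n * (\<Sum>k=1..n. weight \<beta> z0 n k * y k)"

text \<open>
  A scale functional is a \<open>g :: real \<Rightarrow> (real \<Rightarrow> real) \<Rightarrow> real\<close> of which only the values \<open>g x S\<close> with
  \<open>x \<in> {0..1}\<close> and \<open>S \<in> C1\<close> matter. Suprema that need not be finite a priori are taken in
  \<open>ennreal\<close>.
\<close>

definition assumption_A1 :: "real \<Rightarrow> real \<Rightarrow> (real \<Rightarrow> (real \<Rightarrow> real) \<Rightarrow> real) \<Rightarrow> bool" where
  "assumption_A1 \<beta> z0 g \<longleftrightarrow> (\<forall>\<delta>\<in>{0<..<1}.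
     (\<lambda>n. SUP S\<in>weak_holder \<beta> z0 \<delta>.
        ennreal \<bar>sqrt (1 / qn \<beta> z0 n * (\<Sum>k=1..n. weight \<beta> z0 n k * (g (design n k) S)\<^sup>2))
                  - g z0 S\<bar>) \<longlonglongrightarrow> 0)"

definition assumption_A2 :: "(real \<Rightarrow> (real \<Rightarrow> real) \<Rightarrow> real) \<Rightarrow> bool" where
  "assumption_A2 g \<longleftrightarrow>
     (\<exists>g_low g_up. 0 < g_low \<and> (\<forall>x\<in>{0..1}. \<forall>S\<in>C1. g_low \<le> g x S \<and> g x S \<le> g_up))"

definition linear_functional_C1 :: "((real \<Rightarrow> real) \<Rightarrow> real) \<Rightarrow> bool" where
  "linear_functional_C1 F \<longleftrightarrow>
     (\<forall>S\<in>C1. \<forall>T\<in>C1. F (\<lambda>x. S x + T x) = F S + F T)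
     \<and> (\<forall>c. \<forall>S\<in>C1. F (\<lambda>x. c * S x) = c * F S)"

text \<open>
  In the last clause the filter expresses \<open>\<parallel>S\<parallel> \<rightarrow> 0\<close> with \<open>\<parallel>S\<parallel> > 0\<close> and \<open>S \<in> C1\<close>.
\<close>

definition assumption_A3 :: "(real \<Rightarrow> (real \<Rightarrow> real) \<Rightarrow> real) \<Rightarrow> bool" where
  "assumption_A3 g \<longleftrightarrow>
     (\<exists>(Lin :: real \<Rightarrow> (real \<Rightarrow> real) \<Rightarrow> (real \<Rightarrow> real) \<Rightarrow> real)
       (\<Gamma> :: real \<Rightarrow> (real \<Rightarrow> real) \<Rightarrow> (real \<Rightarrow> real) \<Rightarrow> real).
        (\<forall>S\<in>C1. \<forall>S0\<in>C1. \<forall>x\<in>{0..1}.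
            g x S = g x S0 + Lin x S0 (\<lambda>t. S t - S0 t) + \<Gamma> x S0 (\<lambda>t. S t - S0 t))
      \<and> (\<forall>S0\<in>C1. \<forall>x\<in>{0..1}. linear_functional_C1 (Lin x S0))
      \<and> (\<forall>S0\<in>C1. \<exists>C>0. \<forall>x\<in>{0..1}. \<forall>S\<in>C1. supnorm S \<noteq> 0 \<longrightarrow>
            \<bar>Lin x S0 S\<bar> / supnorm S \<le> C)
      \<and> (\<forall>S0\<in>C1. ((\<lambda>S. SUP x\<in>{0..1}. ennreal (\<bar>\<Gamma> x S0 S\<bar> / supnorm S)) \<longlongrightarrow> 0)
            (inf (filtercomap supnorm (at_right 0)) (principal C1))))"

text \<open>
  The law of \<open>(y\<^sub>1, \<dots>, y\<^sub>n)\<close>, \<open>y\<^sub>k = S(x\<^sub>k) + g(x\<^sub>k,S) \<xi>\<^sub>k\<close>, for i.i.d. \<open>\<xi>\<^sub>k\<close> with density \<open>p\<close>.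
\<close>

definition obs_law ::
    "(real \<Rightarrow> (real \<Rightarrow> real) \<Rightarrow> real) \<Rightarrow> nat \<Rightarrow> (real \<Rightarrow> real) \<Rightarrow> (real \<Rightarrow> real) \<Rightarrow> (nat \<Rightarrow> real) measure" where
  "obs_law g n p S =
     distr (PiM {1..n} (\<lambda>_. density lborel p)) (PiM {1..n} (\<lambda>_. borel))
       (\<lambda>\<xi>. \<lambda>k\<in>{1..n}. S (design n k) + g (design n k) S * \<xi> k)"

definition robust_risk ::
    "real \<Rightarrow> real \<Rightarrow> real \<Rightarrow> real \<Rightarrow> (real \<Rightarrow> (real \<Rightarrow> real) \<Rightarrow> real) \<Rightarrow> real \<Rightarrow> nat
       \<Rightarrow> ((nat \<Rightarrow> real) \<Rightarrow> real) \<Rightarrow> ennreal" where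
  "robust_risk \<beta> \<epsilon> L z0 g \<delta> n est =
     (SUP p\<in>noise_densities \<epsilon> L. SUP S\<in>weak_holder \<beta> z0 \<delta>.
        \<integral>\<^sup>+y. ennreal (rate \<beta> n * (\<bar>est y - S z0\<bar> / g z0 S)) \<partial>obs_law g n p S)"

end

theory Submission
  imports Defs
begin

text \<open>
  The error of the kernel estimator splits into a deterministic bias and a weighted sum of the noise.

  The bias is a Riemann sum for the integral that is controlled by \<open>\<delta> h\<^sup>\<beta>\<close> in the definition of the weak
  Hoelder class; the Lipschitz constant \<open>1/\<delta>\<close> makes the discretisation error \<open>O(1/(\<delta> n))\<close>.
  After multiplication by the rate the bias is at most \<open>\<delta>/2 + o(1)\<close>, uniformly in \<open>S\<close>.

  The noise term is \<open>G/\<surd>q\<^sub>n\<close> times \<open>\<bar>\<Sum> a\<^sub>k \<xi>\<^sub>k\<bar>\<close> with \<open>\<Sum> a\<^sub>k\<^sup>2 = 1\<close>, where \<open>G\<close> is the empirical scale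
  of assumption (A1) and the \<open>a\<^sub>k\<close> are of order \<open>1/\<surd>q\<^sub>n\<close> by (A2). Its first absolute moment
  is compared with the Gaussian one by Lindeberg's exchange argument, applied to the smooth majorant
  \<open>\<surd>(\<kappa>\<^sup>2 + x\<^sup>2)\<close> of \<open>\<bar>x\<bar>\<close>. The first two moments of the noise agree with the
  Gaussian ones, so each exchange costs at most \<open>C(\<kappa>) (1 + L) \<bar>a\<^sub>k\<bar>\<^sup>2\<^sup>+\<^sup>\<gamma>\<close> with \<open>\<gamma> = min \<epsilon> 1\<close>.
  This bound depends on the density only through \<open>L\<close>, which gives the required uniformity.
\<close>

section \<open>Lindeberg comparison with the Gaussian law\<close>

text \<open>Lagrange's form puts the second derivative at an intermediate point, so the error is
  \<open>x\<^sup>2 / 2\<close> times an increment of \<open>f2\<close>. The modulus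
  \<open>min 1 \<bar>x - y\<bar>\<close> records at once that \<open>f2\<close> has bounded
  oscillation and is Lipschitz, which bounds the error both quadratically and cubically.\<close>

lemma second_order_remainder:
  fixes f f1 f2 :: "real \<Rightarrow> real"
  assumes f1: "\<And>x. (f has_real_derivative f1 x) (at x)"
    and f2: "\<And>x. (f1 has_real_derivative f2 x) (at x)"
    and B: "\<And>x y. \<bar>f2 x - f2 y\<bar> \<le> B * min 1 \<bar>x - y\<bar>"
  shows "\<bar>f (s + x) - (f s + f1 s * x + f2 s * x\<^sup>2 / 2)\<bar> \<le> B / 2 * (x\<^sup>2 * min 1 \<bar>x\<bar>)"
proof -
  have B0: "0 \<le> B"
    using B[of 1 0] by (simp add: order_trans[OF abs_ge_zero])
  \<comment> \<open>\<open>Maclaurin_bi_le\<close> expands at 0 and takes a sequence of derivatives,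
    hence the shift by \<open>s\<close> and the index \<open>m\<close>.\<close>
  define d where "d m t = (if m = 0 then f (t + s) else if m = Suc 0 then f1 (t + s) else f2 (t + s))"
    for m :: nat and t
  have "\<forall>m t. m < 2 \<and> \<bar>t\<bar> \<le> \<bar>x\<bar> \<longrightarrow> DERIV (d m) t :> d (Suc m) t"
  proof (intro allI impI)
    fix m :: nat and t :: real assume "m < 2 \<and> \<bar>t\<bar> \<le> \<bar>x\<bar>"
    then consider "m = 0" | "m = Suc 0" by linarith
    then show "DERIV (d m) t :> d (Suc m) t"
    proof cases
      case 1
      have "d 0 = (\<lambda>t. f (t + s))" by (simp add: d_def fun_eq_iff)
      then show ?thesis
        using 1 f1[of "t + s"] by (simp add: DERIV_shift d_def)
    next
      case 2
      have "d (Suc 0) = (\<lambda>t. f1 (t + s))" by (simp add: d_def fun_eq_iff)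
      then show ?thesis
        using 2 f2[of "t + s"] by (simp add: DERIV_shift d_def)
    qed
  qed
  from Maclaurin_bi_le[OF refl this] obtain t where t: "\<bar>t\<bar> \<le> \<bar>x\<bar>"
    "d 0 x = (\<Sum>m<2. d m 0 / fact m * x ^ m) + d 2 t / fact 2 * x ^ 2"
    by blast
  then have "f (s + x) - (f s + f1 s * x + f2 s * x\<^sup>2 / 2) = (f2 (s + t) - f2 s) * (x\<^sup>2 / 2)"
    by (simp add: d_def numeral_2_eq_2 field_simps add.commute)
  also have "\<bar>\<dots>\<bar> \<le> (B * min 1 \<bar>x\<bar>) * (x\<^sup>2 / 2)"
    unfolding abs_mult
  proof (rule mult_mono)
    have "\<bar>f2 (s + t) - f2 s\<bar> \<le> B * min 1 \<bar>t\<bar>"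
      using B[of "s + t" s] by simp
    also have "\<dots> \<le> B * min 1 \<bar>x\<bar>"
      using t(1) B0 by (intro mult_left_mono) auto
    finally show "\<bar>f2 (s + t) - f2 s\<bar> \<le> B * min 1 \<bar>x\<bar>" .
  qed (use B0 in auto)
  finally show ?thesis by (simp add: mult_ac)
qed

text \<open>Interpolation between the quadratic and the cubic bound:
  \<open>min 1 \<bar>x\<bar>\<close> is below \<open>\<bar>x\<bar> powr \<gamma>\<close> on either
  side of \<open>\<bar>x\<bar> = 1\<close>; inside the unit interval this is where
  \<open>\<gamma> \<le> 1\<close> enters.\<close>

lemma square_min_le_powr:
  fixes x \<gamma> :: real
  assumes "0 < \<gamma>" "\<gamma> \<le> 1"
  shows "x\<^sup>2 * min 1 \<bar>x\<bar> \<le> \<bar>x\<bar> powr (2 + \<gamma>)"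
proof (cases "x = 0")
  case False
  have "min 1 \<bar>x\<bar> \<le> \<bar>x\<bar> powr \<gamma>"
  proof (cases "\<bar>x\<bar> \<le> 1")
    case True
    then show ?thesis using powr_mono'[of \<gamma> 1 "\<bar>x\<bar>"] assms by auto
  next
    case False
    then show ?thesis using ge_one_powr_ge_zero[of "\<bar>x\<bar>" \<gamma>] assms by auto
  qed
  then have "x\<^sup>2 * min 1 \<bar>x\<bar> \<le> x\<^sup>2 * \<bar>x\<bar> powr \<gamma>"
    by (intro mult_left_mono) auto
  also have "x\<^sup>2 = \<bar>x\<bar> powr 2"
    using False by simp
  finally show ?thesis
    by (simp add: powr_add)
qed simp

text \<open>When the Taylor polynomial is integrated, mean 0 removes the first-order term and
  variance 1 fixes the second-order one. The main term is therefore the same for every such law, and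
  two laws can be compared through it at the cost of two remainders.\<close>

lemma expectation_second_order:
  fixes f f1 f2 :: "real \<Rightarrow> real"
  assumes "prob_space M" and sets: "sets M = sets borel"
    and i1: "integrable M (\<lambda>x. x)" and e1: "(\<integral>x. x \<partial>M) = 0"
    and i2: "integrable M (\<lambda>x. x\<^sup>2)" and e2: "(\<integral>x. x\<^sup>2 \<partial>M) = 1"
    and i3: "integrable M (\<lambda>x. \<bar>x\<bar> powr (2 + \<gamma>))" and e3: "(\<integral>x. \<bar>x\<bar> powr (2 + \<gamma>) \<partial>M) \<le> K"
    and \<gamma>: "0 < \<gamma>" "\<gamma> \<le> 1"
    and f1: "\<And>x. (f has_real_derivative f1 x) (at x)"
    and f2: "\<And>x. (f1 has_real_derivative f2 x) (at x)"
    and B: "\<And>x y. \<bar>f2 x - f2 y\<bar> \<le> B * min 1 \<bar>x - y\<bar>"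
  shows "integrable M (\<lambda>x. f (s + a * x))"
    and "\<bar>(\<integral>x. f (s + a * x) \<partial>M) - (f s + f2 s * a\<^sup>2 / 2)\<bar> \<le> B / 2 * K * \<bar>a\<bar> powr (2 + \<gamma>)"
proof -
  interpret prob_space M by fact
  have B0: "0 \<le> B"
    using B[of 1 0] by (simp add: order_trans[OF abs_ge_zero])
  define q where "q x = f s + f1 s * (a * x) + f2 s * (a * x)\<^sup>2 / 2" for x
  have iq: "integrable M q"
    unfolding q_def using i1 i2 by (simp add: power_mult_distrib)
  have eq: "(\<integral>x. q x \<partial>M) = f s + f2 s * a\<^sup>2 / 2"
    unfolding q_def using i1 i2 e1 e2 by (simp add: power_mult_distrib prob_space)
  have bound: "\<bar>f (s + a * x) - q x\<bar> \<le> B / 2 * \<bar>a\<bar> powr (2 + \<gamma>) * \<bar>x\<bar> powr (2 + \<gamma>)" for x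
  proof -
    have "\<bar>f (s + a * x) - q x\<bar> \<le> B / 2 * ((a * x)\<^sup>2 * min 1 \<bar>a * x\<bar>)"
      unfolding q_def by (rule second_order_remainder[OF f1 f2 B])
    also have "\<dots> \<le> B / 2 * \<bar>a * x\<bar> powr (2 + \<gamma>)"
      using B0 by (intro mult_left_mono square_min_le_powr \<gamma>) auto
    finally show ?thesis by (simp add: abs_mult powr_mult mult_ac)
  qed
  have "continuous_on UNIV f"
    using f1 by (auto intro!: continuous_at_imp_continuous_on DERIV_isCont)
  then have [measurable]: "f \<in> borel_measurable borel"
    by (rule borel_measurable_continuous_onI)
  have [measurable]: "(\<lambda>x. f (s + a * x)) \<in> borel_measurable M"
    unfolding measurable_cong_sets[OF sets refl] by measurable
  have [measurable]: "q \<in> borel_measurable M"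
    using iq by auto
  \<comment> \<open>Only the remainder is dominated by the moment of order
    \<open>2 + \<gamma>\<close>; integrability of \<open>f\<close> then follows by adding the
    polynomial \<open>q\<close> back.\<close>
  have ir: "integrable M (\<lambda>x. f (s + a * x) - q x)"
    by (rule Bochner_Integration.integrable_bound[OF integrable_mult_right[OF i3, of "B / 2 * \<bar>a\<bar> powr (2 + \<gamma>)"]])
      (use bound B0 in auto)
  from Bochner_Integration.integrable_add[OF ir iq] show i: "integrable M (\<lambda>x. f (s + a * x))"
    by simp
  have "\<bar>(\<integral>x. f (s + a * x) \<partial>M) - (f s + f2 s * a\<^sup>2 / 2)\<bar> = \<bar>\<integral>x. f (s + a * x) - q x \<partial>M\<bar>"
    using i iq eq by simp
  also have "\<dots> \<le> (\<integral>x. \<bar>f (s + a * x) - q x\<bar> \<partial>M)"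
    by (rule integral_abs_bound)
  also have "\<dots> \<le> (\<integral>x. B / 2 * \<bar>a\<bar> powr (2 + \<gamma>) * \<bar>x\<bar> powr (2 + \<gamma>) \<partial>M)"
    using ir i3 bound by (intro integral_mono) auto
  also have "\<dots> \<le> B / 2 * \<bar>a\<bar> powr (2 + \<gamma>) * K"
    using e3 B0 by (simp add: mult_left_mono)
  finally show "\<bar>(\<integral>x. f (s + a * x) \<partial>M) - (f s + f2 s * a\<^sup>2 / 2)\<bar> \<le> B / 2 * K * \<bar>a\<bar> powr (2 + \<gamma>)"
    by (simp add: mult_ac)
qed

section \<open>Exchange of the noise coordinates for Gaussian ones\<close>

text \<open>The factors of the product measure are replaced one at a time, by induction on
  \<open>I\<close>. The shift \<open>s\<close> is generalised because the other coordinates act as a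
  constant offset. Values in \<open>ennreal\<close> let Fubini apply without integrability, and the
  constants \<open>r i\<close> integrate to themselves under probability measures.\<close>

lemma lindeberg_exchange:
  fixes f :: "real \<Rightarrow> ennreal" and a :: "'i \<Rightarrow> real"
  assumes "prob_space M" "prob_space N"
    and sets[measurable_cong]: "sets M = sets borel" "sets N = sets borel"
    and [measurable]: "f \<in> borel_measurable borel"
    and "finite I"
    and swap: "\<And>i s. i \<in> I \<Longrightarrow>
      (\<integral>\<^sup>+x. f (s + a i * x) \<partial>M) \<le> (\<integral>\<^sup>+x. f (s + a i * x) \<partial>N) + r i"
  shows "(\<integral>\<^sup>+x. f (s + (\<Sum>i\<in>I. a i * x i)) \<partial>PiM I (\<lambda>_. M))
      \<le> (\<integral>\<^sup>+x. f (s + (\<Sum>i\<in>I. a i * x i)) \<partial>PiM I (\<lambda>_. N)) + (\<Sum>i\<in>I. r i)"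
  using \<open>finite I\<close> swap
proof (induction I arbitrary: s)
  case empty
  then show ?case by (simp add: PiM_empty nn_integral_count_space_finite)
next
  case (insert i I)
  interpret M: prob_space M by fact
  interpret N: prob_space N by fact
  interpret PM: product_prob_space "\<lambda>_. M" I ..
  interpret PN: product_prob_space "\<lambda>_. N" I ..
  have upd: "(\<Sum>j\<in>insert i I. a j * (x(i := y)) j) = a i * y + (\<Sum>j\<in>I. a j * x j)"
    for x :: "'i \<Rightarrow> real" and y
    using insert.hyps by (auto intro!: sum.cong)
  have "(\<integral>\<^sup>+x. f (s + (\<Sum>i\<in>insert i I. a i * x i)) \<partial>PiM (insert i I) (\<lambda>_. M))
      = (\<integral>\<^sup>+x. (\<integral>\<^sup>+y. f ((s + (\<Sum>j\<in>I. a j * x j)) + a i * y) \<partial>M) \<partial>PiM I (\<lambda>_. M))"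
    by (subst PM.product_nn_integral_insert[OF insert.hyps])
      (measurable, simp only: upd, simp add: ac_simps)
  also have "\<dots> \<le> (\<integral>\<^sup>+x. (\<integral>\<^sup>+y. f ((s + (\<Sum>j\<in>I. a j * x j)) + a i * y) \<partial>N) + r i \<partial>PiM I (\<lambda>_. M))"
    by (intro nn_integral_mono insert.prems) auto
  also have "\<dots> = (\<integral>\<^sup>+x. (\<integral>\<^sup>+y. f ((s + (\<Sum>j\<in>I. a j * x j)) + a i * y) \<partial>N) \<partial>PiM I (\<lambda>_. M)) + r i"
    by (subst nn_integral_add) (auto simp: PM.P.emeasure_space_1)
  \<comment> \<open>After Fubini the coordinate \<open>i\<close>, already distributed as
    \<open>N\<close>, is the outer variable, and \<open>a i * y\<close> joins the shift to which the
    induction hypothesis is applied.\<close>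
  also have "(\<integral>\<^sup>+x. (\<integral>\<^sup>+y. f ((s + (\<Sum>j\<in>I. a j * x j)) + a i * y) \<partial>N) \<partial>PiM I (\<lambda>_. M))
      = (\<integral>\<^sup>+y. (\<integral>\<^sup>+x. f ((s + a i * y) + (\<Sum>j\<in>I. a j * x j)) \<partial>PiM I (\<lambda>_. M)) \<partial>N)"
    by (subst pair_sigma_finite.Fubini')
      (auto simp: ac_simps intro!: pair_sigma_finite.intro PM.P.sigma_finite_measure_axioms N.sigma_finite_measure_axioms)
  also have "\<dots> \<le> (\<integral>\<^sup>+y. (\<integral>\<^sup>+x. f ((s + a i * y) + (\<Sum>j\<in>I. a j * x j)) \<partial>PiM I (\<lambda>_. N)) + (\<Sum>j\<in>I. r j) \<partial>N)"
    by (intro nn_integral_mono insert.IH insert.prems) auto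
  also have "\<dots> = (\<integral>\<^sup>+y. (\<integral>\<^sup>+x. f ((s + a i * y) + (\<Sum>j\<in>I. a j * x j)) \<partial>PiM I (\<lambda>_. N)) \<partial>N) + (\<Sum>j\<in>I. r j)"
    by (subst nn_integral_add) (auto simp: N.emeasure_space_1)
  also have "(\<integral>\<^sup>+y. (\<integral>\<^sup>+x. f ((s + a i * y) + (\<Sum>j\<in>I. a j * x j)) \<partial>PiM I (\<lambda>_. N)) \<partial>N)
      = (\<integral>\<^sup>+x. f (s + (\<Sum>i\<in>insert i I. a i * x i)) \<partial>PiM (insert i I) (\<lambda>_. N))"
    by (subst PN.product_nn_integral_insert_rev[OF insert.hyps])
      (measurable, simp only: upd, simp add: ac_simps)
  finally show ?case
    using insert.hyps by (simp add: add_mono ac_simps)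
qed

text \<open>A linear combination of independent standard normals is centred normal, with variance
  the sum of the squared coefficients, here 1.\<close>

lemma nn_integral_normal_linear_combination:
  fixes f :: "real \<Rightarrow> ennreal" and a :: "'i \<Rightarrow> real"
  assumes [measurable]: "f \<in> borel_measurable borel"
    and "finite I" and unit: "(\<Sum>i\<in>I. (a i)\<^sup>2) = 1"
  defines "N \<equiv> density lborel std_normal_density"
  shows "(\<integral>\<^sup>+x. f (\<Sum>i\<in>I. a i * x i) \<partial>PiM I (\<lambda>_. N)) = (\<integral>\<^sup>+x. f x \<partial>N)"
proof -
  interpret N: prob_space N
    unfolding N_def by (rule prob_space_normal_density) simp
  have [measurable_cong]: "sets N = sets borel" by (simp add: N_def)
  interpret PN: product_prob_space "\<lambda>_. N" I ..
  \<comment> \<open>Coordinates with zero coefficient are discarded: a degenerate normal law has no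
    density, and the rules for affine images and sums of normals ask for positive standard
    deviations.\<close>
  define J where "J = {i\<in>I. a i \<noteq> 0}"
  have J: "finite J" "J \<subseteq> I" using \<open>finite I\<close> by (auto simp: J_def)
  have sumJ: "(\<Sum>i\<in>I. a i * x i) = (\<Sum>i\<in>J. a i * x i)" for x
    unfolding J_def using \<open>finite I\<close> by (intro sum.mono_neutral_right) auto
  have unitJ: "(\<Sum>i\<in>J. (a i)\<^sup>2) = 1"
    unfolding unit[symmetric] J_def using \<open>finite I\<close> by (intro sum.mono_neutral_left) auto
  have J0: "J \<noteq> {}" using unitJ by auto
  have comp: "distr (PiM I (\<lambda>_. N)) N (\<lambda>x. x i) = N" if "i \<in> I" for i
    using that by (intro distr_PiM_component \<open>finite I\<close> N.prob_space_axioms)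
  have compb: "distr (PiM I (\<lambda>_. N)) borel (\<lambda>x. x i) = N" if "i \<in> I" for i
    using comp[OF that] by (metis distr_cong \<open>sets N = sets borel\<close>)
  have "PN.P.indep_vars (\<lambda>_. borel) (\<lambda>i x. x i) I"
  proof (subst PN.P.indep_vars_iff_distr_eq_PiM')
    show "I \<noteq> {}" using J0 J by auto
    show "(\<lambda>x. x i) \<in> PiM I (\<lambda>_. N) \<rightarrow>\<^sub>M borel" if "i \<in> I" for i
      using that by measurable
    \<comment> \<open>On the space of the product measure, restriction to \<open>I\<close> changes
      nothing; the joint law of the coordinates is thus the product of their marginals, which is
      independence.\<close>
    have "distr (PiM I (\<lambda>_. N)) (PiM I (\<lambda>_. borel)) (\<lambda>x. \<lambda>i\<in>I. x i)
        = distr (PiM I (\<lambda>_. N)) (PiM I (\<lambda>_. N)) (\<lambda>x. x)"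
      by (intro distr_cong refl sets_PiM_cong)
        (auto simp: space_PiM \<open>sets N = sets borel\<close> intro!: restrict_PiE_iff[THEN iffD1] PiE_restrict)
    also have "\<dots> = PiM I (\<lambda>_. N)" by (rule distr_id)
    also have "\<dots> = PiM I (\<lambda>i. distr (PiM I (\<lambda>_. N)) borel (\<lambda>x. x i))"
      by (intro PiM_cong refl) (simp add: compb)
    finally show "distr (PiM I (\<lambda>_. N)) (PiM I (\<lambda>_. borel)) (\<lambda>x. \<lambda>i\<in>I. x i)
        = PiM I (\<lambda>i. distr (PiM I (\<lambda>_. N)) borel (\<lambda>x. x i))" .
  qed
  then have "PN.P.indep_vars (\<lambda>_. borel) (\<lambda>i x. x i) J"
    using J(2) by (rule PN.P.indep_vars_subset)
  then have indep: "PN.P.indep_vars (\<lambda>_. borel) (\<lambda>i. (\<lambda>y. a i * y) \<circ> (\<lambda>x. x i)) J"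
    by (rule PN.P.indep_vars_compose) measurable
  have normal: "distributed (PiM I (\<lambda>_. N)) lborel (\<lambda>x. 0 + a i * x i)
      (normal_density (0 + a i * 0) (\<bar>a i\<bar> * 1))" if "i \<in> J" for i
  proof (rule PN.P.normal_density_affine)
    have "i \<in> I" using that J by auto
    then show "distributed (PiM I (\<lambda>_. N)) lborel (\<lambda>x. x i) std_normal_density"
      unfolding distributed_def using compb[of i]
      by (auto simp: N_def cong: distr_cong)
  qed (use that in \<open>auto simp: J_def\<close>)
  have "distributed (PiM I (\<lambda>_. N)) lborel (\<lambda>x. \<Sum>i\<in>J. a i * x i)
      (normal_density (\<Sum>i\<in>J. 0) (sqrt (\<Sum>i\<in>J. \<bar>a i\<bar>\<^sup>2)))"
    by (rule PN.P.sum_indep_normal)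
      (use J J0 indep normal in \<open>auto simp: comp_def J_def\<close>)
  then have d: "distributed (PiM I (\<lambda>_. N)) lborel (\<lambda>x. \<Sum>i\<in>J. a i * x i) std_normal_density"
    by (simp add: unitJ)
  have "(\<integral>\<^sup>+x. f x \<partial>N) = (\<integral>\<^sup>+x. std_normal_density x * f x \<partial>lborel)"
    unfolding N_def by (subst nn_integral_density) auto
  also have "\<dots> = (\<integral>\<^sup>+x. f (\<Sum>i\<in>J. a i * x i) \<partial>PiM I (\<lambda>_. N))"
    by (rule distributed_nn_integral[OF d]) simp
  finally show ?thesis by (simp add: sumJ)
qed

section \<open>Smoothing of the absolute value and the first moment of the weighted noise\<close>

text \<open>The second derivative lies between 0 and \<open>1 / \<kappa>\<close> and has slope at
  most \<open>3 / \<kappa>\<^sup>2\<close>. The first fact serves points more than 1 apart, the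
  second nearby points, and the sum of the constants serves both.\<close>

lemma smooth_abs_derivatives:
  fixes \<kappa> :: real
  assumes "0 < \<kappa>"
  defines "f \<equiv> \<lambda>x. sqrt (\<kappa>\<^sup>2 + x\<^sup>2)"
  shows "(f has_real_derivative x / f x) (at x)"
    and "((\<lambda>x. x / f x) has_real_derivative \<kappa>\<^sup>2 / f x ^ 3) (at x)"
    and "\<bar>\<kappa>\<^sup>2 / f x ^ 3 - \<kappa>\<^sup>2 / f y ^ 3\<bar> \<le> (1 / \<kappa> + 3 / \<kappa>\<^sup>2) * min 1 \<bar>x - y\<bar>"
proof -
  have pos: "0 < \<kappa>\<^sup>2 + x\<^sup>2" for x
    using assms(1) by (simp add: add_pos_nonneg)
  have f_pos: "0 < f x" for x
    using pos by (simp add: f_def)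
  have f_sq: "f x ^ 2 = \<kappa>\<^sup>2 + x\<^sup>2" for x
    using pos[of x] by (simp add: f_def)
  have f_ge: "\<kappa> \<le> f x" "\<bar>x\<bar> \<le> f x" for x
    by (auto simp: f_def intro!: real_le_rsqrt)
  show d: "(f has_real_derivative x / f x) (at x)" for x
    unfolding f_def using pos[of x] by (auto intro!: derivative_eq_intros simp: field_simps)
  show "((\<lambda>x. x / f x) has_real_derivative \<kappa>\<^sup>2 / f x ^ 3) (at x)"
  proof -
    have "((\<lambda>x. x / f x) has_real_derivative (1 * f x - x * (x / f x)) / (f x * f x)) (at x)"
      using f_pos[of x] by (intro DERIV_divide d DERIV_ident) auto
    also have "(1 * f x - x * (x / f x)) / (f x * f x) = (f x ^ 2 - x\<^sup>2) / f x ^ 3"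
      using f_pos[of x] by (simp add: field_simps power2_eq_square power3_eq_cube)
    finally show ?thesis by (simp add: f_sq)
  qed
  define f2 where "f2 x = \<kappa>\<^sup>2 / f x ^ 3" for x
  have d2: "(f2 has_real_derivative - 3 * \<kappa>\<^sup>2 * x / f x ^ 5) (at x)" for x
  proof -
    have "(f2 has_real_derivative (0 * f x ^ 3 - \<kappa>\<^sup>2 * (3 * (x / f x) * f x ^ 2)) / (f x ^ 3 * f x ^ 3)) (at x)"
      unfolding f2_def using f_pos[of x]
      by (auto intro!: DERIV_divide derivative_eq_intros d)
    also have "(0 * f x ^ 3 - \<kappa>\<^sup>2 * (3 * (x / f x) * f x ^ 2)) / (f x ^ 3 * f x ^ 3) = - 3 * \<kappa>\<^sup>2 * x / f x ^ 5"
      using f_pos[of x] by (simp add: divide_simps) (simp add: power_numeral_reduce algebra_simps)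
    finally show ?thesis .
  qed
  have slope: "\<bar>- 3 * \<kappa>\<^sup>2 * x / f x ^ 5\<bar> \<le> 3 / \<kappa>\<^sup>2" for x
  proof -
    have "\<bar>- 3 * \<kappa>\<^sup>2 * x / f x ^ 5\<bar> = 3 * (\<kappa>\<^sup>2 * \<bar>x\<bar>) / f x ^ 5"
      using f_pos[of x] by (simp add: abs_mult)
    \<comment> \<open>Bounding \<open>\<kappa>\<close> and \<open>\<bar>x\<bar>\<close> by
      \<open>f x\<close> cancels three of the five powers in the denominator.\<close>
    also have "\<dots> \<le> 3 * (f x ^ 2 * f x) / f x ^ 5"
      using f_ge[of x] f_pos[of x] assms(1)
      by (intro divide_right_mono mult_left_mono mult_mono power_mono) auto
    also have "\<dots> = 3 / f x ^ 2"
      using f_pos[of x] by (simp add: divide_simps) (simp add: power_numeral_reduce)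
    also have "\<dots> \<le> 3 / \<kappa>\<^sup>2"
      using f_ge[of x] f_pos[of x] assms(1) by (intro divide_left_mono power_mono) auto
    finally show ?thesis .
  qed
  have lip: "\<bar>f2 x - f2 y\<bar> \<le> 3 / \<kappa>\<^sup>2 * \<bar>x - y\<bar>"
    using field_differentiable_bound[of UNIV f2 "\<lambda>x. - 3 * \<kappa>\<^sup>2 * x / f x ^ 5" "3 / \<kappa>\<^sup>2" x y] d2 slope
    by simp
  have bnd: "0 \<le> f2 x" "f2 x \<le> 1 / \<kappa>" for x
  proof -
    show "0 \<le> f2 x" using f_pos[of x] by (simp add: f2_def)
    have "f2 x \<le> \<kappa>\<^sup>2 / \<kappa> ^ 3"
      unfolding f2_def using f_ge[of x] f_pos[of x] assms(1) by (intro divide_left_mono power_mono) auto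
    then show "f2 x \<le> 1 / \<kappa>"
      using assms(1) by (simp add: power2_eq_square power3_eq_cube)
  qed
  have "\<bar>f2 x - f2 y\<bar> \<le> (1 / \<kappa> + 3 / \<kappa>\<^sup>2) * min 1 \<bar>x - y\<bar>"
  proof (cases "\<bar>x - y\<bar> \<le> 1")
    case True
    have "\<bar>f2 x - f2 y\<bar> \<le> (1 / \<kappa> + 3 / \<kappa>\<^sup>2) * \<bar>x - y\<bar>"
      using assms(1) by (intro order_trans[OF lip] mult_right_mono) auto
    then show ?thesis using True by (simp add: min_def)
  next
    case False
    have "\<bar>f2 x - f2 y\<bar> \<le> 1 / \<kappa>"
      using bnd[of x] bnd[of y] by linarith
    also have "\<dots> \<le> 1 / \<kappa> + 3 / \<kappa>\<^sup>2" by simp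
    finally show ?thesis using False by (simp add: min_def)
  qed
  then show "\<bar>\<kappa>\<^sup>2 / f x ^ 3 - \<kappa>\<^sup>2 / f y ^ 3\<bar> \<le> (1 / \<kappa> + 3 / \<kappa>\<^sup>2) * min 1 \<bar>x - y\<bar>"
    by (simp add: f2_def)
qed

text \<open>The Taylor remainder admits only exponents up to 3, whereas \<open>\<epsilon>\<close>
  may be large; hence the minimum with 1. The power \<open>2 + \<gamma>\<close> is below the square
  inside the unit interval and below the power \<open>2 + \<epsilon>\<close> outside, and the
  integrals of these two give the constant \<open>1 + L\<close>.\<close>

lemma noise_density_moments:
  assumes p: "p \<in> noise_densities \<epsilon> L" and "0 < \<epsilon>" "0 < L"
  defines "M \<equiv> density lborel p" and "\<gamma> \<equiv> min \<epsilon> 1"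
  shows "prob_space M"
    and "integrable M (\<lambda>x. x)" and "(\<integral>x. x \<partial>M) = 0"
    and "integrable M (\<lambda>x. x\<^sup>2)" and "(\<integral>x. x\<^sup>2 \<partial>M) = 1"
    and "integrable M (\<lambda>x. \<bar>x\<bar> powr (2 + \<gamma>))" and "(\<integral>x. \<bar>x\<bar> powr (2 + \<gamma>) \<partial>M) \<le> 1 + L"
proof -
  have [measurable]: "p \<in> borel_measurable borel" and p0: "\<And>x. 0 \<le> p x"
    and b1: "has_bochner_integral lborel (\<lambda>x. x * p x) 0"
    and b2: "has_bochner_integral lborel (\<lambda>x. x\<^sup>2 * p x) 1"
    and m: "(\<integral>\<^sup>+x. ennreal (\<bar>x\<bar> powr (2 + \<epsilon>) * p x) \<partial>lborel) \<le> ennreal L"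
    and pr: "prob_space (density lborel p)"
    using p by (auto simp: noise_densities_def)
  show "prob_space M" using pr by (simp add: M_def)
  have b1': "has_bochner_integral M (\<lambda>x. x) 0" and b2': "has_bochner_integral M (\<lambda>x. x\<^sup>2) 1"
    unfolding M_def using b1 b2 p0
    by (auto intro!: has_bochner_integral_density simp: mult.commute)
  then show "integrable M (\<lambda>x. x)" "(\<integral>x. x \<partial>M) = 0"
    and i2: "integrable M (\<lambda>x. x\<^sup>2)" and e2: "(\<integral>x. x\<^sup>2 \<partial>M) = 1"
    by (auto simp: has_bochner_integral_iff)
  have "(\<integral>\<^sup>+x. ennreal (\<bar>x\<bar> powr (2 + \<epsilon>)) \<partial>M) = (\<integral>\<^sup>+x. ennreal (\<bar>x\<bar> powr (2 + \<epsilon>) * p x) \<partial>lborel)"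
    unfolding M_def by (subst nn_integral_density) (auto simp: ennreal_mult p0 mult.commute)
  with m have nn: "(\<integral>\<^sup>+x. ennreal (\<bar>x\<bar> powr (2 + \<epsilon>)) \<partial>M) \<le> ennreal L" by simp
  have i\<epsilon>: "integrable M (\<lambda>x. \<bar>x\<bar> powr (2 + \<epsilon>))"
    by (rule integrableI_bounded) (use nn in \<open>auto simp: M_def intro: le_less_trans\<close>)
  have "ennreal (\<integral>x. \<bar>x\<bar> powr (2 + \<epsilon>) \<partial>M) \<le> ennreal L"
    using nn nn_integral_eq_integral[OF i\<epsilon>] by simp
  then have e\<epsilon>: "(\<integral>x. \<bar>x\<bar> powr (2 + \<epsilon>) \<partial>M) \<le> L"
    using \<open>0 < L\<close> by (simp add: ennreal_le_iff)
  have le: "\<bar>x\<bar> powr (2 + \<gamma>) \<le> x\<^sup>2 + \<bar>x\<bar> powr (2 + \<epsilon>)" for x :: real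
  proof (cases "\<bar>x\<bar> \<le> 1")
    case True
    have "\<bar>x\<bar> powr (2 + \<gamma>) \<le> \<bar>x\<bar> powr 2"
      using True \<open>0 < \<epsilon>\<close> by (intro powr_mono') (auto simp: \<gamma>_def)
    also have "\<dots> = x\<^sup>2" by (cases "x = 0") auto
    finally show ?thesis by (simp add: add_increasing2)
  next
    case False
    then have "\<bar>x\<bar> powr (2 + \<gamma>) \<le> \<bar>x\<bar> powr (2 + \<epsilon>)"
      by (intro powr_mono) (auto simp: \<gamma>_def)
    then show ?thesis by (simp add: add_increasing)
  qed
  show i: "integrable M (\<lambda>x. \<bar>x\<bar> powr (2 + \<gamma>))"
    by (rule Bochner_Integration.integrable_bound[OF Bochner_Integration.integrable_add[OF i2 i\<epsilon>]])
      (use le in \<open>auto simp: M_def\<close>)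
  have "(\<integral>x. \<bar>x\<bar> powr (2 + \<gamma>) \<partial>M) \<le> (\<integral>x. x\<^sup>2 + \<bar>x\<bar> powr (2 + \<epsilon>) \<partial>M)"
    using i i2 i\<epsilon> le by (intro integral_mono) auto
  also have "\<dots> \<le> 1 + L"
    using i2 i\<epsilon> e2 e\<epsilon> by simp
  finally show "(\<integral>x. \<bar>x\<bar> powr (2 + \<gamma>) \<partial>M) \<le> 1 + L" .
qed

text \<open>The absolute value is replaced by its smooth majorant before the exchange, and the
  majorant by \<open>\<bar>x\<bar> + \<kappa>\<close> afterwards, so smoothing costs only
  \<open>\<kappa>\<close>. The Gaussian density is itself admissible and therefore obeys the same
  moment bound.\<close>

lemma weighted_noise_first_moment:
  fixes a :: "'i \<Rightarrow> real"
  assumes p: "p \<in> noise_densities \<epsilon> L" and normal: "std_normal_density \<in> noise_densities \<epsilon> L"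
    and "0 < \<epsilon>" "0 < L" "0 < \<kappa>" and "finite I" and unit: "(\<Sum>i\<in>I. (a i)\<^sup>2) = 1"
  shows "(\<integral>\<^sup>+x. ennreal \<bar>\<Sum>i\<in>I. a i * x i\<bar> \<partial>PiM I (\<lambda>_. density lborel p))
      \<le> ennreal ((\<integral>x. \<bar>x\<bar> \<partial>density lborel std_normal_density) + \<kappa>
          + (1 / \<kappa> + 3 / \<kappa>\<^sup>2) * (1 + L) * (\<Sum>i\<in>I. \<bar>a i\<bar> powr (2 + min \<epsilon> 1)))"
proof -
  define M N where "M = density lborel p" and "N = density lborel std_normal_density"
  define \<gamma> where "\<gamma> = min \<epsilon> 1"
  define B where "B = 1 / \<kappa> + 3 / \<kappa>\<^sup>2"
  define f where "f x = sqrt (\<kappa>\<^sup>2 + x\<^sup>2)" for x :: real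
  define r where "r i = B * (1 + L) * \<bar>a i\<bar> powr (2 + \<gamma>)" for i
  have \<gamma>: "0 < \<gamma>" "\<gamma> \<le> 1" using \<open>0 < \<epsilon>\<close> by (auto simp: \<gamma>_def)
  have r0: "0 \<le> r i" for i
    using \<open>0 < \<kappa>\<close> \<open>0 < L\<close> by (simp add: r_def B_def)
  note Mp = noise_density_moments[OF p \<open>0 < \<epsilon>\<close> \<open>0 < L\<close>, folded M_def \<gamma>_def]
  note Np = noise_density_moments[OF normal \<open>0 < \<epsilon>\<close> \<open>0 < L\<close>, folded N_def \<gamma>_def]
  have sets: "sets M = sets borel" "sets N = sets borel" by (auto simp: M_def N_def)
  interpret N: prob_space N by (rule Np(1))
  have f0: "0 \<le> f x" for x by (simp add: f_def)
  have f_le: "f x \<le> \<bar>x\<bar> + \<kappa>" for x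
    unfolding f_def using \<open>0 < \<kappa>\<close> by (intro real_le_lsqrt) (auto simp: power2_sum)
  have f_ge: "\<bar>x\<bar> \<le> f x" for x
    unfolding f_def by (intro real_le_rsqrt) auto
  have [measurable]: "f \<in> borel_measurable borel" unfolding f_def by measurable
  note deriv = smooth_abs_derivatives[OF \<open>0 < \<kappa>\<close>, folded f_def B_def]
  note eM = expectation_second_order[OF Mp(1) sets(1) Mp(2-7) \<gamma> deriv]
  note eN = expectation_second_order[OF Np(1) sets(2) Np(2-7) \<gamma> deriv]
  have swap: "(\<integral>\<^sup>+x. ennreal (f (s + a i * x)) \<partial>M) \<le> (\<integral>\<^sup>+x. ennreal (f (s + a i * x)) \<partial>N) + ennreal (r i)"
    for s i
  proof -
    \<comment> \<open>Both laws share the second-order main term; each contributes a remainder with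
      factor \<open>B / 2\<close>, and the two add up to \<open>r i\<close>.\<close>
    have "(\<integral>x. f (s + a i * x) \<partial>M) \<le> (\<integral>x. f (s + a i * x) \<partial>N) + r i"
      using eM(2)[of s "a i"] eN(2)[of s "a i"] unfolding r_def by argo
    then show ?thesis
      using eM(1)[of s "a i"] eN(1)[of s "a i"] f0 r0
      by (simp add: nn_integral_eq_integral flip: ennreal_plus)
  qed
  have iabs: "integrable N (\<lambda>x. \<bar>x\<bar>)"
    using Np(2) by (rule integrable_abs)
  have "(\<integral>\<^sup>+x. ennreal \<bar>\<Sum>i\<in>I. a i * x i\<bar> \<partial>PiM I (\<lambda>_. M))
      \<le> (\<integral>\<^sup>+x. ennreal (f (0 + (\<Sum>i\<in>I. a i * x i))) \<partial>PiM I (\<lambda>_. M))"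
    by (intro nn_integral_mono ennreal_leI) (simp add: f_ge)
  also have "\<dots> \<le> (\<integral>\<^sup>+x. ennreal (f (0 + (\<Sum>i\<in>I. a i * x i))) \<partial>PiM I (\<lambda>_. N)) + (\<Sum>i\<in>I. ennreal (r i))"
    by (rule lindeberg_exchange[OF Mp(1) Np(1) sets _ \<open>finite I\<close> swap]) measurable
  also have "(\<integral>\<^sup>+x. ennreal (f (0 + (\<Sum>i\<in>I. a i * x i))) \<partial>PiM I (\<lambda>_. N)) = (\<integral>\<^sup>+x. ennreal (f x) \<partial>N)"
    unfolding N_def using nn_integral_normal_linear_combination[OF _ \<open>finite I\<close> unit, of "\<lambda>x. ennreal (f x)"]
    by simp
  also have "\<dots> \<le> (\<integral>\<^sup>+x. ennreal (\<bar>x\<bar> + \<kappa>) \<partial>N)"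
    by (intro nn_integral_mono ennreal_leI f_le)
  also have "\<dots> = ennreal ((\<integral>x. \<bar>x\<bar> \<partial>N) + \<kappa>)"
    using iabs \<open>0 < \<kappa>\<close> by (subst nn_integral_eq_integral) (auto simp: N.prob_space)
  also have "(\<Sum>i\<in>I. ennreal (r i)) = ennreal (B * (1 + L) * (\<Sum>i\<in>I. \<bar>a i\<bar> powr (2 + \<gamma>)))"
    using r0 by (subst sum_ennreal) (auto simp: r_def sum_distrib_left)
  also have "ennreal ((\<integral>x. \<bar>x\<bar> \<partial>N) + \<kappa>) + \<dots>
      = ennreal ((\<integral>x. \<bar>x\<bar> \<partial>N) + \<kappa> + B * (1 + L) * (\<Sum>i\<in>I. \<bar>a i\<bar> powr (2 + \<gamma>)))"
    using \<open>0 < \<kappa>\<close> \<open>0 < L\<close>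
    by (intro ennreal_plus[symmetric]) (auto simp: B_def intro!: add_nonneg_nonneg mult_nonneg_nonneg sum_nonneg)
  finally show ?thesis
    by (simp add: M_def N_def B_def \<gamma>_def add_right_mono)
qed

section \<open>Bias of the kernel estimator\<close>

text \<open>\<open>a\<close> and \<open>b\<close> are the ceiling and the floor of the ends of the
  window on the index scale. The first two hypotheses keep all indices of the window between 1 and
  \<open>n\<close>; the third makes it long enough for \<open>a \<le> b\<close>. The arbitrary
  \<open>c\<close> lets the same window serve for counting and for summation.\<close>

lemma kernel_window:
  fixes z0 h :: real
  assumes "h < z0" "z0 + h \<le> 1" "1 \<le> real n * h"
  shows "\<exists>a b. 1 \<le> a \<and> a \<le> b \<and> b \<le> n
    \<and> real n * (z0 - h) \<le> real a \<and> real a < real n * (z0 - h) + 1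
    \<and> real n * (z0 + h) - 1 < real b \<and> real b \<le> real n * (z0 + h)
    \<and> (\<forall>c. (\<Sum>k=1..n. kern ((design n k - z0) / h) * c k) = (\<Sum>k=a..b. c k))"
proof -
  have n: "0 < real n" and h: "0 < h"
    using less_le_trans[OF zero_less_one assms(3)] by (auto simp: zero_less_mult_iff)
  define a b where "a = nat \<lceil>real n * (z0 - h)\<rceil>" and "b = nat \<lfloor>real n * (z0 + h)\<rfloor>"
  have lo: "0 < real n * (z0 - h)" and hi: "0 < real n * (z0 + h)"
    using n h assms by auto
  have a: "real n * (z0 - h) \<le> real a" "real a < real n * (z0 - h) + 1"
    using lo unfolding a_def by linarith+
  have b: "real n * (z0 + h) - 1 < real b" "real b \<le> real n * (z0 + h)"
    using hi unfolding b_def by linarith+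
  have "1 \<le> a" using lo a by linarith
  have "real n * (z0 + h) \<le> real n * 1"
    using assms n by (intro mult_left_mono) auto
  then have "b \<le> n" using b by linarith
  have "real n * (z0 + h) = real n * (z0 - h) + 2 * (real n * h)"
    by (simp add: algebra_simps)
  then have "a \<le> b" using a b assms(3) by linarith
  have iff: "kern ((design n k - z0) / h) = (if a \<le> k \<and> k \<le> b then 1 else 0)" for k
  proof -
    have "(design n k - z0) / h \<in> {-1..1} \<longleftrightarrow> real n * (z0 - h) \<le> real k \<and> real k \<le> real n * (z0 + h)"
      using n h by (auto simp: design_def field_simps)
    also have "\<dots> \<longleftrightarrow> a \<le> k \<and> k \<le> b"
      unfolding a_def b_def using lo hi by linarith
    finally show ?thesis by (auto simp: kern_def indicator_def)
  qed
  have "(\<Sum>k=1..n. kern ((design n k - z0) / h) * c k) = (\<Sum>k=a..b. c k)" for c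
  proof -
    have "(\<Sum>k=1..n. kern ((design n k - z0) / h) * c k) = (\<Sum>k=1..n. if k \<in> {a..b} then c k else 0)"
      by (intro sum.cong) (auto simp: iff)
    also have "\<dots> = (\<Sum>k\<in>{1..n} \<inter> {a..b}. c k)"
      by (rule sum.inter_restrict[symmetric]) simp
    also have "{1..n} \<inter> {a..b} = {a..b}"
      using \<open>1 \<le> a\<close> \<open>b \<le> n\<close> by auto
    finally show ?thesis .
  qed
  then show ?thesis
    using \<open>1 \<le> a\<close> \<open>a \<le> b\<close> \<open>b \<le> n\<close> a b by (intro exI[of _ a] exI[of _ b] conjI allI)
qed

text \<open>The factor \<open>h\<close> in the error compensates the later division by
  \<open>qn\<close>, of order \<open>n h\<close>. It arises because \<open>D z0 = 0\<close> bounds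
  \<open>D\<close> by \<open>\<Lambda> * h\<close> on the window, and because at most
  \<open>2 n h\<close> cells cost \<open>\<Lambda> / n\<^sup>2\<close> each. The constant 5 is 1 for
  each end piece, 2 for the cells and 1 for the last sample.\<close>

lemma riemann_sum_window:
  fixes D :: "real \<Rightarrow> real"
  assumes lip: "\<And>x y. x \<in> {0..1} \<Longrightarrow> y \<in> {0..1} \<Longrightarrow> \<bar>D x - D y\<bar> \<le> \<Lambda> * \<bar>x - y\<bar>"
    and D0: "D z0 = 0" and z0: "h < z0" "z0 + h \<le> 1" and nh: "1 \<le> real n * h"
  shows "\<bar>1 / real n * (\<Sum>k=1..n. kern ((design n k - z0) / h) * D (design n k))
      - h * (LINT u:{-1..1}|lborel. D (z0 + h * u))\<bar> \<le> 5 * \<Lambda> * h / real n"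
proof -
  have n: "0 < real n" and h: "0 < h"
    using less_le_trans[OF zero_less_one nh] by (auto simp: zero_less_mult_iff)
  have \<Lambda>: "0 \<le> \<Lambda>"
    using lip[of 0 1] by simp
  have "\<Lambda>-lipschitz_on {0..1} D"
    using lip \<Lambda> by (intro lipschitz_onI) (auto simp: dist_real_def)
  then have cont: "continuous_on {0..1} D"
    by (rule lipschitz_on_continuous_on)
  obtain a b where ab: "1 \<le> a" "a \<le> b" "b \<le> n"
    "real n * (z0 - h) \<le> real a" "real a < real n * (z0 - h) + 1"
    "real n * (z0 + h) - 1 < real b" "real b \<le> real n * (z0 + h)"
    and sum_eq: "\<forall>c. (\<Sum>k=1..n. kern ((design n k - z0) / h) * c k) = (\<Sum>k=a..b. c k)"
    using kernel_window[OF z0 nh] by (elim exE conjE) blast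
  define F where "F x = integral {0..x} D" for x
  have F: "(F has_real_derivative D x) (at x within {0..1})" if "x \<in> {0..1}" for x
    unfolding F_def using integral_has_real_derivative[OF cont that] .
  \<comment> \<open>Mean value bound for \<open>F\<close> minus its linearisation of slope
    \<open>D c\<close>. The base point is free: \<open>z0\<close> for the end pieces, where the
    linear term vanishes, and the left end point for each cell.\<close>
  have local: "\<bar>F y - F x - D c * (y - x)\<bar> \<le> \<Lambda> * \<rho> * (y - x)"
    if "0 \<le> x" "x \<le> y" "y \<le> 1" "c \<in> {0..1}" "\<And>t. x \<le> t \<Longrightarrow> t \<le> y \<Longrightarrow> \<bar>t - c\<bar> \<le> \<rho>" for x y c \<rho>
  proof -
    have "norm ((F y - D c * y) - (F x - D c * x)) \<le> (\<Lambda> * \<rho>) * norm (y - x)"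
    proof (rule field_differentiable_bound[where S="{x..y}" and f'="\<lambda>t. D t - D c"])
      show "((\<lambda>t. F t - D c * t) has_real_derivative D t - D c) (at t within {x..y})" if t: "t \<in> {x..y}" for t
      proof -
        have "(F has_real_derivative D t) (at t within {x..y})"
          using t that(1) \<open>0 \<le> x\<close> \<open>y \<le> 1\<close> by (intro DERIV_subset[OF F]) auto
        then show ?thesis by (auto intro!: derivative_eq_intros)
      qed
      show "norm (D t - D c) \<le> \<Lambda> * \<rho>" if t: "t \<in> {x..y}" for t
      proof -
        have "\<bar>D t - D c\<bar> \<le> \<Lambda> * \<bar>t - c\<bar>"
          using t \<open>0 \<le> x\<close> \<open>y \<le> 1\<close> \<open>c \<in> {0..1}\<close> by (intro lip) auto
        also have "\<dots> \<le> \<Lambda> * \<rho>"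
          using t \<Lambda> \<open>\<And>t. x \<le> t \<Longrightarrow> t \<le> y \<Longrightarrow> \<bar>t - c\<bar> \<le> \<rho>\<close>[of t] by (intro mult_left_mono) auto
        finally show ?thesis by simp
      qed
    qed (use that in auto)
    then show ?thesis using that(2) by (simp add: algebra_simps)
  qed
  have lo: "0 \<le> z0 - h" and z0': "z0 \<in> {0..1}" using z0 h by auto
  have scale: "z0 - h = real n * (z0 - h) / n" "z0 - h + 1 / n = (real n * (z0 - h) + 1) / n"
    "z0 + h - 1 / n = (real n * (z0 + h) - 1) / n" "z0 + h = real n * (z0 + h) / n"
    using n by (simp_all add: add_divide_distrib diff_divide_distrib)
  have a_n: "z0 - h \<le> real a / n" "real a / n \<le> z0 - h + 1 / n"
    and b_n: "z0 + h - 1 / n \<le> real b / n" "real b / n \<le> z0 + h"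
    using ab by (subst scale, intro divide_right_mono; simp)+
  have mono: "real i / n \<le> real j / n" if "i \<le> j" for i j
    using that n by (simp add: divide_right_mono)
  \<comment> \<open>The two end pieces have length at most \<open>1 / n\<close>, and \<open>\<bar>D\<bar> \<le> \<Lambda> * h\<close> on the window because \<open>D z0 = 0\<close>.\<close>
  have e1: "\<bar>F (z0 + h) - F (real b / n)\<bar> \<le> \<Lambda> * h * (1 / n)"
  proof -
    have "\<bar>F (z0 + h) - F (real b / n) - D z0 * (z0 + h - real b / n)\<bar> \<le> \<Lambda> * h * (z0 + h - real b / n)"
      using b_n a_n mono[OF \<open>a \<le> b\<close>] lo z0 z0' by (intro local) auto
    also have "\<dots> \<le> \<Lambda> * h * (1 / n)"
      using b_n \<Lambda> h by (intro mult_left_mono) auto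
    finally show ?thesis by (simp add: D0)
  qed
  have e2: "\<bar>F (real a / n) - F (z0 - h)\<bar> \<le> \<Lambda> * h * (1 / n)"
  proof -
    have "\<bar>F (real a / n) - F (z0 - h) - D z0 * (real a / n - (z0 - h))\<bar> \<le> \<Lambda> * h * (real a / n - (z0 - h))"
      using b_n a_n mono[OF \<open>a \<le> b\<close>] lo z0 z0' by (intro local) auto
    also have "\<dots> \<le> \<Lambda> * h * (1 / n)"
      using a_n \<Lambda> h by (intro mult_left_mono) auto
    finally show ?thesis by (simp add: D0)
  qed
  have e3: "\<bar>(F (real b / n) - F (real a / n)) - (\<Sum>k=a..<b. D (real k / n) * (1 / n))\<bar> \<le> 2 * \<Lambda> * h / n"
  proof -
    have tele: "F (real b / n) - F (real a / n) = (\<Sum>k=a..<b. F (real (Suc k) / n) - F (real k / n))"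
      using sum_Suc_diff'[OF \<open>a \<le> b\<close>, of "\<lambda>k. F (real k / n)"] by simp
    have "\<bar>(F (real b / n) - F (real a / n)) - (\<Sum>k=a..<b. D (real k / n) * (1 / n))\<bar>
        = \<bar>\<Sum>k=a..<b. F (real (Suc k) / n) - F (real k / n) - D (real k / n) * (1 / n)\<bar>"
      by (simp add: tele sum_subtractf)
    also have "\<dots> \<le> (\<Sum>k=a..<b. \<Lambda> * (1 / n) * (1 / n))"
    proof (intro order_trans[OF sum_abs] sum_mono)
      fix k assume k: "k \<in> {a..<b}"
      have step: "real (Suc k) / n - real k / n = 1 / n" by (simp add: add_divide_distrib)
      have kn: "real (Suc k) / n \<le> 1" using k ab(3) n by simp
      have "\<bar>F (real (Suc k) / n) - F (real k / n) - D (real k / n) * (real (Suc k) / n - real k / n)\<bar>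
          \<le> \<Lambda> * (1 / n) * (real (Suc k) / n - real k / n)"
      proof (rule local)
        show "\<bar>t - real k / n\<bar> \<le> 1 / n" if "real k / n \<le> t" "t \<le> real (Suc k) / n" for t
          using that step by linarith
      qed (use kn step n mono[of k "Suc k"] in auto)
      then show "\<bar>F (real (Suc k) / n) - F (real k / n) - D (real k / n) * (1 / n)\<bar> \<le> \<Lambda> * (1 / n) * (1 / n)"
        by (simp only: step)
    qed
    also have "\<dots> = (real b - real a) * (\<Lambda> * (1 / n) * (1 / n))"
      using ab(2) by simp
    also have "\<dots> \<le> (2 * (n * h)) * (\<Lambda> * (1 / n) * (1 / n))"
      using ab \<Lambda> n by (intro mult_right_mono) (auto simp: algebra_simps)
    also have "\<dots> = 2 * \<Lambda> * h / n"
      using n by (simp add: field_simps)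
    finally show ?thesis .
  qed
  \<comment> \<open>The left-endpoint rule on \<open>{a..<b}\<close> omits the index
    \<open>b\<close>, which the kernel sum contains; its term is bounded separately.\<close>
  have e4: "\<bar>D (real b / n) * (1 / n)\<bar> \<le> \<Lambda> * h * (1 / n)"
  proof -
    have "real a / n \<le> real b / n" using mono[OF ab(2)] .
    have "1 / n \<le> h" using nh n by (simp add: field_simps)
    have "\<bar>D (real b / n) - D z0\<bar> \<le> \<Lambda> * \<bar>real b / n - z0\<bar>"
      using z0' b_n z0 by (intro lip) auto
    also have "\<dots> \<le> \<Lambda> * h"
      using b_n \<open>real a / n \<le> real b / n\<close> a_n \<Lambda> by (intro mult_left_mono) auto
    finally show ?thesis using n by (simp add: D0 abs_mult divide_right_mono)
  qed
  have FTC: "(LINT u:{-1..1}|lborel. D (z0 + h * u)) = (F (z0 + h) - F (z0 - h)) / h"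
  proof -
    have in01: "z0 + h * u \<in> {0..1}" if "u \<in> {-1..1}" for u
    proof -
      have "h * u \<le> h * 1" "h * (-1) \<le> h * u"
        using that h by (intro mult_left_mono; simp)+
      then show ?thesis using z0 by simp
    qed
    have "(\<integral>u. indicator {-1..1} u *\<^sub>R D (z0 + h * u) \<partial>lborel) = F (z0 + h * 1) / h - F (z0 + h * (-1)) / h"
    proof (rule integral_FTC_Icc)
      show "continuous_on {-1..1} (\<lambda>u. D (z0 + h * u))"
        using in01 by (intro continuous_on_compose2[OF cont] continuous_intros) auto
      fix u :: real assume u: "-1 \<le> u" "u \<le> 1"
      have "((F \<circ> (\<lambda>u. z0 + h * u)) has_real_derivative D (z0 + h * u) * h) (at u within {-1..1})"
      proof (rule DERIV_image_chain)
        show "(F has_real_derivative D (z0 + h * u)) (at (z0 + h * u) within (\<lambda>u. z0 + h * u) ` {-1..1})"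
          using in01 u by (intro DERIV_subset[OF F]) auto
      qed (auto intro!: derivative_eq_intros)
      from DERIV_cdivide[OF this, of h]
      show "((\<lambda>u. F (z0 + h * u) / h) has_vector_derivative D (z0 + h * u)) (at u within {-1..1})"
        using h by (simp add: comp_def has_real_derivative_iff_has_vector_derivative)
    qed simp
    then show ?thesis
      by (simp add: set_lebesgue_integral_def diff_divide_distrib)
  qed
  have last: "(\<Sum>k=a..b. D (real k / n) * (1 / n))
      = (\<Sum>k=a..<b. D (real k / n) * (1 / n)) + D (real b / n) * (1 / n)"
    using ab(2) by (simp add: atLeastLessThanSuc_atLeastAtMost[symmetric])
  have "1 / real n * (\<Sum>k=1..n. kern ((design n k - z0) / h) * D (design n k))
      = (\<Sum>k=a..b. D (real k / n) * (1 / n))"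
    by (subst sum_eq[rule_format]) (simp add: design_def sum_distrib_left)
  moreover have "h * (LINT u:{-1..1}|lborel. D (z0 + h * u)) = F (z0 + h) - F (z0 - h)"
    using h by (simp add: FTC)
  moreover have "5 * \<Lambda> * h / n = \<Lambda> * h * (1 / n) + \<Lambda> * h * (1 / n) + 2 * \<Lambda> * h / n + \<Lambda> * h * (1 / n)"
    by simp
  ultimately show ?thesis
    using e1 e2 e3 e4 last by linarith
qed

section \<open>From the Riemann sum to the bias over the weak Hoelder class\<close>

lemma weak_holder_lipschitz:
  assumes S: "S \<in> weak_holder \<beta> z0 \<delta>" and xy: "x \<in> {0..1}" "y \<in> {0..1}"
  shows "\<bar>S x - S y\<bar> \<le> inverse \<delta> * \<bar>x - y\<bar>"
proof -
  have C1: "S \<in> C1" and sup: "supnorm (deriv01 S) \<le> inverse \<delta>"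
    using S by (auto simp: weak_holder_def holder_class_def holder_ball_def)
  have "norm (S x - S y) \<le> inverse \<delta> * norm (x - y)"
  proof (rule field_differentiable_bound[where S="{0..1}" and f'="deriv01 S"])
    fix t :: real assume t: "t \<in> {0..1}"
    have "S differentiable (at t within {0..1})" using C1 t by (auto simp: C1_def)
    then show "(S has_real_derivative deriv01 S t) (at t within {0..1})"
      by (simp add: deriv01_def vector_derivative_works has_real_derivative_iff_has_vector_derivative)
    \<comment> \<open>\<open>supnorm\<close> is a real supremum, which is known to dominate the
      values only for a bounded function; continuity on a compact interval supplies the
      bound.\<close>
    have "continuous_on {0..1} (\<lambda>x. \<bar>deriv01 S x\<bar>)"
      using C1 by (auto simp: C1_def intro: continuous_intros)
    then have "bdd_above ((\<lambda>x. \<bar>deriv01 S x\<bar>) ` {0..1})"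
      by (intro bounded_imp_bdd_above compact_imp_bounded compact_continuous_image) auto
    then have "\<bar>deriv01 S t\<bar> \<le> supnorm (deriv01 S)"
      unfolding supnorm_def using t by (intro cSUP_upper)
    then show "norm (deriv01 S t) \<le> inverse \<delta>" using sup by simp
  qed (use xy in auto)
  then show ?thesis by simp
qed

text \<open>\<open>qn\<close> counts the integers in an interval of length \<open>2 n h\<close>, and
  such a count differs from the length by at most 1.\<close>

lemma qn_bounds:
  assumes "bandwidth \<beta> n < z0" "z0 + bandwidth \<beta> n \<le> 1" "1 \<le> real n * bandwidth \<beta> n"
  shows "2 * (real n * bandwidth \<beta> n) - 1 \<le> qn \<beta> z0 n" "qn \<beta> z0 n \<le> 2 * (real n * bandwidth \<beta> n) + 1"
proof -
  obtain a b where ab: "1 \<le> a" "a \<le> b" "b \<le> n"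
    "real n * (z0 - bandwidth \<beta> n) \<le> real a" "real a < real n * (z0 - bandwidth \<beta> n) + 1"
    "real n * (z0 + bandwidth \<beta> n) - 1 < real b" "real b \<le> real n * (z0 + bandwidth \<beta> n)"
    and sum_eq: "\<forall>c. (\<Sum>k=1..n. kern ((design n k - z0) / bandwidth \<beta> n) * c k) = (\<Sum>k=a..b. c k)"
    using kernel_window[OF assms] by (elim exE conjE) blast
  have "qn \<beta> z0 n = real b + 1 - real a"
    using sum_eq[rule_format, of "\<lambda>_. 1"] ab(2) by (simp add: qn_def weight_def)
  then show "2 * (real n * bandwidth \<beta> n) - 1 \<le> qn \<beta> z0 n" "qn \<beta> z0 n \<le> 2 * (real n * bandwidth \<beta> n) + 1"
    using ab by (auto simp: algebra_simps)
qed

text \<open>The weights sum to \<open>qn\<close>, so the bias is a weighted mean of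
  \<open>S - S z0\<close>. Its Riemann sum is close to \<open>h\<close> times the integral that the
  class controls, taken at \<open>t = h\<close>.\<close>

lemma bias_bound:
  assumes S: "S \<in> weak_holder \<beta> z0 \<delta>"
    and "bandwidth \<beta> n < z0" "z0 + bandwidth \<beta> n \<le> 1" "1 \<le> real n * bandwidth \<beta> n"
  shows "\<bar>kernel_estimator \<beta> z0 n (\<lambda>k. S (design n k)) - S z0\<bar>
      \<le> real n * bandwidth \<beta> n / qn \<beta> z0 n * (\<delta> * bandwidth \<beta> n powr \<beta> + 5 * inverse \<delta> / real n)"
proof -
  define h q where "h = bandwidth \<beta> n" and "q = qn \<beta> z0 n"
  have n: "0 < real n" and h: "0 < h"
    using less_le_trans[OF zero_less_one assms(4)] unfolding h_def by (auto simp: zero_less_mult_iff)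
  have q: "0 < q"
    using qn_bounds(1)[OF assms(2-4)] assms(4) by (simp add: q_def)
  define D where "D x = S x - S z0" for x
  define R where "R = (\<Sum>k=1..n. weight \<beta> z0 n k * D (design n k))"
  have "R = (\<Sum>k=1..n. weight \<beta> z0 n k * S (design n k)) - q * S z0"
    by (simp add: R_def D_def q_def qn_def right_diff_distrib sum_subtractf sum_distrib_right)
  then have bias: "kernel_estimator \<beta> z0 n (\<lambda>k. S (design n k)) - S z0 = real n / q * (1 / real n * R)"
    using q n by (simp add: kernel_estimator_def q_def field_simps)
  have riemann: "\<bar>1 / real n * R - h * (LINT u:{-1..1}|lborel. D (z0 + h * u))\<bar> \<le> 5 * inverse \<delta> * h / real n"
    unfolding R_def weight_def h_def[symmetric]
  proof (rule riemann_sum_window)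
    show "\<bar>D x - D y\<bar> \<le> inverse \<delta> * \<bar>x - y\<bar>" if "x \<in> {0..1}" "y \<in> {0..1}" for x y
      using weak_holder_lipschitz[OF S that] by (simp add: D_def)
  qed (use assms in \<open>auto simp: D_def h_def\<close>)
  have "{z0 - h..z0 + h} \<subseteq> {0..1}" using assms(2,3) by (auto simp: h_def)
  then have "\<bar>LINT u:{-1..1}|lborel. D (z0 + h * u)\<bar> \<le> \<delta> * h powr \<beta>"
    using S h by (auto simp: weak_holder_def D_def)
  then have "\<bar>h * (LINT u:{-1..1}|lborel. D (z0 + h * u))\<bar> \<le> h * (\<delta> * h powr \<beta>)"
    unfolding abs_mult using h by (intro mult_mono) auto
  with riemann have "\<bar>1 / real n * R\<bar> \<le> h * (\<delta> * h powr \<beta>) + 5 * inverse \<delta> * h / real n"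
    by linarith
  then have "real n / q * \<bar>1 / real n * R\<bar> \<le> real n / q * (h * (\<delta> * h powr \<beta>) + 5 * inverse \<delta> * h / real n)"
    using n q by (intro mult_left_mono) auto
  also have "\<dots> = real n * h / q * (\<delta> * h powr \<beta> + 5 * inverse \<delta> / real n)"
    using n q by (simp add: field_simps)
  finally show ?thesis
    unfolding bias h_def[symmetric] q_def[symmetric] using n q by (simp add: abs_mult)
qed

section \<open>Uniform risk bound\<close>

text \<open>The quantity that (A1) compares with \<open>g z0 S\<close>. As the weights are 0 or 1,
  its square divided by \<open>qn\<close> is the variance of the kernel estimator under independent
  noise of variance 1.\<close>

definition empirical_scale ::
    "real \<Rightarrow> real \<Rightarrow> (real \<Rightarrow> (real \<Rightarrow> real) \<Rightarrow> real) \<Rightarrow> nat \<Rightarrow> (real \<Rightarrow> real) \<Rightarrow> real" where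
  "empirical_scale \<beta> z0 g n S =
     sqrt (1 / qn \<beta> z0 n * (\<Sum>k=1..n. weight \<beta> z0 n k * (g (design n k) S)\<^sup>2))"

lemma weight_cases: "weight \<beta> z0 n k = 0 \<or> weight \<beta> z0 n k = 1"
  by (simp add: weight_def kern_def indicator_def)

text \<open>Pulling \<open>G / sqrt q\<close> out of the noise term leaves coefficients of unit
  Euclidean norm, to which the Gaussian comparison applies. The ratio of \<open>G\<close> to
  \<open>g z0 S\<close> stays explicit because (A1) will bring it close to 1.\<close>

lemma integrated_loss_bound:
  assumes p: "p \<in> noise_densities \<epsilon> L" and normal: "std_normal_density \<in> noise_densities \<epsilon> L"
    and "0 < \<epsilon>" "0 < L" "0 < \<kappa>"
    and S: "S \<in> C1" and z0: "z0 \<in> {0..1}" and q: "0 < qn \<beta> z0 n"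
    and "0 < l" and g: "\<And>x. x \<in> {0..1} \<Longrightarrow> l \<le> g x S \<and> g x S \<le> u"
  shows "(\<integral>\<^sup>+y. ennreal (rate \<beta> n * (\<bar>kernel_estimator \<beta> z0 n y - S z0\<bar> / g z0 S)) \<partial>obs_law g n p S)
      \<le> ennreal (rate \<beta> n * \<bar>kernel_estimator \<beta> z0 n (\<lambda>k. S (design n k)) - S z0\<bar> / g z0 S
          + rate \<beta> n / sqrt (qn \<beta> z0 n) * (empirical_scale \<beta> z0 g n S / g z0 S)
            * ((\<integral>x. \<bar>x\<bar> \<partial>density lborel std_normal_density) + \<kappa>
               + (1 / \<kappa> + 3 / \<kappa>\<^sup>2) * (1 + L) * (u / l / sqrt (qn \<beta> z0 n)) powr min \<epsilon> 1))"
proof -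
  define q w x G r where "q = qn \<beta> z0 n" and "w = weight \<beta> z0 n" and "x = design n"
    and "G = empirical_scale \<beta> z0 g n S" and "r = rate \<beta> n"
  define bias where "bias = kernel_estimator \<beta> z0 n (\<lambda>k. S (x k)) - S z0"
  define a where "a k = w k * g (x k) S / (sqrt q * G)" for k
  define m where "m = (\<integral>x. \<bar>x\<bar> \<partial>density lborel std_normal_density)"
  define \<gamma> where "\<gamma> = min \<epsilon> 1"
  define W where "W = m + \<kappa> + (1 / \<kappa> + 3 / \<kappa>\<^sup>2) * (1 + L) * (u / l / sqrt q) powr \<gamma>"
  define I where "I = {1..n}"
  have q0: "0 < q" using q by (simp add: q_def)
  have r0: "0 \<le> r" by (simp add: r_def rate_def)
  have m0: "0 \<le> m" unfolding m_def by simp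
  have W0: "0 \<le> W"
    using m0 \<open>0 < \<kappa>\<close> \<open>0 < L\<close> by (simp add: W_def)
  have x01: "x k \<in> {0..1}" if "k \<in> I" for k
    using that by (auto simp: x_def design_def I_def)
  have gz: "l \<le> g z0 S" using g z0 by auto
  have w01: "w k = 0 \<or> w k = 1" for k
    using weight_cases by (simp add: w_def)
  have sum_w: "(\<Sum>k\<in>I. w k) = q" by (simp add: w_def q_def qn_def I_def)
  \<comment> \<open>The lower bound on \<open>G\<close> makes the division in \<open>a\<close>
    legitimate and later bounds the coefficients uniformly in \<open>S\<close>.\<close>
  have G_sq: "1 / q * (\<Sum>k\<in>I. w k * (g (x k) S)\<^sup>2) = G\<^sup>2" and G_ge: "l \<le> G"
  proof -
    have "(\<Sum>k\<in>I. w k * l\<^sup>2) \<le> (\<Sum>k\<in>I. w k * (g (x k) S)\<^sup>2)"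
      using w01 g x01 \<open>0 < l\<close>
      by (intro sum_mono mult_left_mono power_mono) (auto, metis zero_le_one order_refl)
    then have ge: "l\<^sup>2 \<le> 1 / q * (\<Sum>k\<in>I. w k * (g (x k) S)\<^sup>2)"
      using q0 sum_w by (simp add: sum_distrib_right[symmetric] field_simps)
    have G: "G = sqrt (1 / q * (\<Sum>k\<in>I. w k * (g (x k) S)\<^sup>2))"
      by (simp add: G_def empirical_scale_def q_def w_def x_def I_def)
    show "l \<le> G" unfolding G using ge by (rule real_le_rsqrt)
    show "1 / q * (\<Sum>k\<in>I. w k * (g (x k) S)\<^sup>2) = G\<^sup>2"
      unfolding G using ge zero_le_power2[of l] by (intro real_sqrt_pow2[symmetric]) linarith
  qed
  have G0: "0 < G" using G_ge \<open>0 < l\<close> by linarith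
  have a_sq: "(a k)\<^sup>2 = w k * (g (x k) S)\<^sup>2 / (q * G\<^sup>2)" for k
    using w01[of k] q0 by (auto simp: a_def power_mult_distrib power_divide)
  have unit: "(\<Sum>k\<in>I. (a k)\<^sup>2) = 1"
    using G_sq q0 G0 by (simp add: a_sq sum_divide_distrib[symmetric] field_simps)
  have a_le: "\<bar>a k\<bar> \<le> u / l / sqrt q" if "k \<in> I" for k
  proof -
    have gk: "l \<le> g (x k) S" "g (x k) S \<le> u" using g x01[OF that] by auto
    have "\<bar>a k\<bar> \<le> g (x k) S / (sqrt q * G)"
      using w01[of k] gk q0 G0 \<open>0 < l\<close> by (auto simp: a_def)
    also have "\<dots> \<le> u / (sqrt q * l)"
      using gk q0 G_ge \<open>0 < l\<close> by (intro frac_le mult_left_mono) auto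
    finally show ?thesis by (simp add: mult.commute)
  qed
  \<comment> \<open>Lyapunov's condition: the power \<open>\<gamma>\<close> of a uniform bound on
    the coefficients, of order \<open>1 / sqrt q\<close>, is pulled out, and the remaining squares
    sum to 1.\<close>
  have "(\<Sum>k\<in>I. \<bar>a k\<bar> powr (2 + \<gamma>)) \<le> (\<Sum>k\<in>I. (a k)\<^sup>2 * (u / l / sqrt q) powr \<gamma>)"
  proof (rule sum_mono)
    fix k assume k: "k \<in> I"
    have "\<bar>a k\<bar> powr (2 + \<gamma>) = (a k)\<^sup>2 * \<bar>a k\<bar> powr \<gamma>"
      by (cases "a k = 0") (auto simp: powr_add)
    also have "\<dots> \<le> (a k)\<^sup>2 * (u / l / sqrt q) powr \<gamma>"
      using a_le[OF k] \<open>0 < \<epsilon>\<close> by (intro mult_left_mono powr_mono2) (auto simp: \<gamma>_def)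
    finally show "\<bar>a k\<bar> powr (2 + \<gamma>) \<le> (a k)\<^sup>2 * (u / l / sqrt q) powr \<gamma>" .
  qed
  also have "\<dots> = (u / l / sqrt q) powr \<gamma>"
    by (simp only: sum_distrib_right[symmetric] unit mult_1)
  finally have lyapunov: "(\<Sum>k\<in>I. \<bar>a k\<bar> powr (2 + \<gamma>)) \<le> (u / l / sqrt q) powr \<gamma>" .
  have "(\<integral>\<^sup>+\<xi>. ennreal \<bar>\<Sum>k\<in>I. a k * \<xi> k\<bar> \<partial>PiM I (\<lambda>_. density lborel p))
      \<le> ennreal (m + \<kappa> + (1 / \<kappa> + 3 / \<kappa>\<^sup>2) * (1 + L) * (\<Sum>k\<in>I. \<bar>a k\<bar> powr (2 + \<gamma>)))"
    unfolding m_def \<gamma>_def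
    by (rule weighted_noise_first_moment[OF p normal \<open>0 < \<epsilon>\<close> \<open>0 < L\<close> \<open>0 < \<kappa>\<close> _ unit]) (simp add: I_def)
  also have "\<dots> \<le> ennreal W"
    unfolding W_def using lyapunov \<open>0 < \<kappa>\<close> \<open>0 < L\<close>
    by (intro ennreal_leI add_left_mono mult_left_mono) auto
  finally have noise: "(\<integral>\<^sup>+\<xi>. ennreal \<bar>\<Sum>k\<in>I. a k * \<xi> k\<bar> \<partial>PiM I (\<lambda>_. density lborel p)) \<le> ennreal W" .
  define Y where "Y \<xi> = (\<lambda>k\<in>I. S (x k) + g (x k) S * \<xi> k)" for \<xi> :: "nat \<Rightarrow> real"
  have loss: "r * (\<bar>kernel_estimator \<beta> z0 n (Y \<xi>) - S z0\<bar> / g z0 S)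
      \<le> r * \<bar>bias\<bar> / g z0 S + r / sqrt q * (G / g z0 S) * \<bar>\<Sum>k\<in>I. a k * \<xi> k\<bar>" for \<xi>
  proof -
    have "kernel_estimator \<beta> z0 n (Y \<xi>) - S z0 = bias + 1 / q * (\<Sum>k\<in>I. w k * g (x k) S * \<xi> k)"
      by (simp add: kernel_estimator_def bias_def Y_def q_def w_def I_def distrib_left sum.distrib mult.assoc)
    also have "1 / q * (\<Sum>k\<in>I. w k * g (x k) S * \<xi> k) = G / sqrt q * (\<Sum>k\<in>I. a k * \<xi> k)"
      unfolding sum_distrib_left a_def using q0 G0 by (intro sum.cong refl) (simp add: field_simps)
    finally have "\<bar>kernel_estimator \<beta> z0 n (Y \<xi>) - S z0\<bar> \<le> \<bar>bias\<bar> + \<bar>G / sqrt q * (\<Sum>k\<in>I. a k * \<xi> k)\<bar>"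
      by (simp only: abs_triangle_ineq)
    also have "\<bar>G / sqrt q * (\<Sum>k\<in>I. a k * \<xi> k)\<bar> = G / sqrt q * \<bar>\<Sum>k\<in>I. a k * \<xi> k\<bar>"
      using G0 q0 by (simp add: abs_mult)
    finally have "r * (\<bar>kernel_estimator \<beta> z0 n (Y \<xi>) - S z0\<bar> / g z0 S)
        \<le> r * ((\<bar>bias\<bar> + G / sqrt q * \<bar>\<Sum>k\<in>I. a k * \<xi> k\<bar>) / g z0 S)"
      using r0 gz \<open>0 < l\<close> by (intro mult_left_mono divide_right_mono) auto
    also have "\<dots> = r * \<bar>bias\<bar> / g z0 S + r / sqrt q * (G / g z0 S) * \<bar>\<Sum>k\<in>I. a k * \<xi> k\<bar>"
      by (simp add: add_divide_distrib distrib_left)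
    finally show ?thesis .
  qed
  interpret P: prob_space "density lborel p"
    using noise_density_moments(1)[OF p \<open>0 < \<epsilon>\<close> \<open>0 < L\<close>] .
  interpret PP: product_prob_space "\<lambda>_. density lborel p" I ..
  have Y_meas: "Y \<in> PiM I (\<lambda>_. density lborel p) \<rightarrow>\<^sub>M PiM I (\<lambda>_. borel)"
    unfolding Y_def by (intro measurable_restrict) measurable
  have [measurable]: "kernel_estimator \<beta> z0 n \<in> borel_measurable (PiM I (\<lambda>_. borel))"
    unfolding kernel_estimator_def I_def by measurable
  have c0: "0 \<le> r * \<bar>bias\<bar> / g z0 S" "0 \<le> r / sqrt q * (G / g z0 S)"
    using r0 gz \<open>0 < l\<close> G0 q0 by auto
  have "(\<integral>\<^sup>+y. ennreal (r * (\<bar>kernel_estimator \<beta> z0 n y - S z0\<bar> / g z0 S)) \<partial>obs_law g n p S)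
      = (\<integral>\<^sup>+\<xi>. ennreal (r * (\<bar>kernel_estimator \<beta> z0 n (Y \<xi>) - S z0\<bar> / g z0 S)) \<partial>PiM I (\<lambda>_. density lborel p))"
    unfolding obs_law_def I_def[symmetric] x_def[symmetric] Y_def[symmetric]
    by (rule nn_integral_distr[OF Y_meas]) measurable
  also have "\<dots> \<le> (\<integral>\<^sup>+\<xi>. ennreal (r * \<bar>bias\<bar> / g z0 S)
      + ennreal (r / sqrt q * (G / g z0 S)) * ennreal \<bar>\<Sum>k\<in>I. a k * \<xi> k\<bar> \<partial>PiM I (\<lambda>_. density lborel p))"
  proof (rule nn_integral_mono)
    fix \<xi>
    show "ennreal (r * (\<bar>kernel_estimator \<beta> z0 n (Y \<xi>) - S z0\<bar> / g z0 S))
        \<le> ennreal (r * \<bar>bias\<bar> / g z0 S) + ennreal (r / sqrt q * (G / g z0 S)) * ennreal \<bar>\<Sum>k\<in>I. a k * \<xi> k\<bar>"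
      using ennreal_leI[OF loss[of \<xi>]] c0
      by (simp only: ennreal_plus ennreal_mult abs_ge_zero mult_nonneg_nonneg)
  qed
  also have "\<dots> = ennreal (r * \<bar>bias\<bar> / g z0 S) + ennreal (r / sqrt q * (G / g z0 S))
      * (\<integral>\<^sup>+\<xi>. ennreal \<bar>\<Sum>k\<in>I. a k * \<xi> k\<bar> \<partial>PiM I (\<lambda>_. density lborel p))"
    by (subst nn_integral_add) (auto simp: nn_integral_cmult PP.P.emeasure_space_1)
  also have "\<dots> \<le> ennreal (r * \<bar>bias\<bar> / g z0 S) + ennreal (r / sqrt q * (G / g z0 S)) * ennreal W"
    using noise by (intro add_left_mono mult_left_mono) auto
  also have "\<dots> = ennreal (r * \<bar>bias\<bar> / g z0 S + r / sqrt q * (G / g z0 S) * W)"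
    using c0 W0 by (simp only: ennreal_plus ennreal_mult mult_nonneg_nonneg)
  finally show ?thesis
    by (simp add: r_def q_def G_def W_def bias_def m_def \<gamma>_def x_def)
qed

section \<open>Powers of \<open>n\<close>: bandwidth, rate and number of design points in the
  window\<close>

text \<open>The exponents balance the two errors: the bias scale \<open>h powr \<beta>\<close> and
  the noise scale \<open>1 / sqrt (n h)\<close> both equal the reciprocal of the rate. The vanishing
  of \<open>rate / n\<close> absorbs the discretisation error.\<close>

lemma bandwidth_asymptotics:
  assumes "0 < \<beta>"
  shows "bandwidth \<beta> \<longlonglongrightarrow> 0" and "filterlim (\<lambda>n. real n * bandwidth \<beta> n) at_top sequentially"
    and "(\<lambda>n. rate \<beta> n / real n) \<longlonglongrightarrow> 0"
    and "0 < n \<Longrightarrow> rate \<beta> n * bandwidth \<beta> n powr \<beta> = 1"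
    and "0 < n \<Longrightarrow> rate \<beta> n = sqrt (real n * bandwidth \<beta> n)"
proof -
  have nh: "real n * bandwidth \<beta> n = real n powr (2 * \<beta> / (2 * \<beta> + 1))" if "0 < n" for n
  proof -
    have "real n * bandwidth \<beta> n = real n powr (1 + - 1 / (2 * \<beta> + 1))"
      using that by (simp only: powr_add) (simp add: bandwidth_def)
    also have "1 + - 1 / (2 * \<beta> + 1) = 2 * \<beta> / (2 * \<beta> + 1)"
      using assms by (simp add: field_simps)
    finally show ?thesis .
  qed
  show "bandwidth \<beta> \<longlonglongrightarrow> 0"
    unfolding bandwidth_def[abs_def] using assms
    by (intro tendsto_neg_powr filterlim_real_sequentially) auto
  have "(\<lambda>n. real n powr - (2 * \<beta> / (2 * \<beta> + 1))) \<longlonglongrightarrow> 0"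
    using assms by (intro tendsto_neg_powr filterlim_real_sequentially) auto
  moreover have "\<forall>\<^sub>F n in sequentially. 0 < real n powr - (2 * \<beta> / (2 * \<beta> + 1))"
    using eventually_gt_at_top[of 0] by eventually_elim simp
  ultimately have "filterlim (\<lambda>n. inverse (real n powr - (2 * \<beta> / (2 * \<beta> + 1)))) at_top sequentially"
    by (rule filterlim_inverse_at_top)
  then have "filterlim (\<lambda>n. real n powr (2 * \<beta> / (2 * \<beta> + 1))) at_top sequentially"
    by (simp only: powr_minus inverse_inverse_eq)
  then show "filterlim (\<lambda>n. real n * bandwidth \<beta> n) at_top sequentially"
    by (rule filterlim_cong[OF refl refl, THEN iffD1, rotated])
      (use eventually_gt_at_top[of 0] in eventually_elim, simp add: nh)
  have "(\<lambda>n. real n powr (- (\<beta> + 1) / (2 * \<beta> + 1))) \<longlonglongrightarrow> 0"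
    using assms by (intro tendsto_neg_powr filterlim_real_sequentially divide_neg_pos) auto
  then show "(\<lambda>n. rate \<beta> n / real n) \<longlonglongrightarrow> 0"
  proof (rule Lim_transform_eventually)
    show "\<forall>\<^sub>F n in sequentially. real n powr (- (\<beta> + 1) / (2 * \<beta> + 1)) = rate \<beta> n / real n"
      using eventually_gt_at_top[of 0]
    proof eventually_elim
      case (elim n)
      have "- (\<beta> + 1) / (2 * \<beta> + 1) = \<beta> / (2 * \<beta> + 1) - 1"
        using assms by (simp add: field_simps)
      then show ?case
        using elim by (simp only: powr_diff) (simp add: rate_def)
    qed
  qed
  show "rate \<beta> n * bandwidth \<beta> n powr \<beta> = 1" if "0 < n"
    using that by (simp add: rate_def bandwidth_def powr_powr powr_add[symmetric])
  show "rate \<beta> n = sqrt (real n * bandwidth \<beta> n)" if "0 < n"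
  proof -
    have "\<beta> / (2 * \<beta> + 1) = 2 * \<beta> / (2 * \<beta> + 1) * (1 / 2)"
      using assms by (simp add: field_simps)
    then have "rate \<beta> n = (real n powr (2 * \<beta> / (2 * \<beta> + 1))) powr (1 / 2)"
      by (simp only: rate_def powr_powr)
    then show ?thesis
      by (simp only: powr_half_sqrt powr_ge_zero nh[OF that])
  qed
qed

text \<open>A squeeze gives \<open>qn / (n h)\<close> the limit 2, the length of the support of the
  kernel. Since the rate is \<open>sqrt (n h)\<close>, this produces the factor
  \<open>1 / sqrt 2\<close> of the final bound.\<close>

lemma qn_asymptotics:
  assumes "0 < \<beta>" "0 < z0" "z0 < 1"
  shows "\<forall>\<^sub>F n in sequentially. 0 < n \<and> bandwidth \<beta> n < z0 \<and> z0 + bandwidth \<beta> n \<le> 1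
      \<and> 1 \<le> real n * bandwidth \<beta> n"
    and "(\<lambda>n. real n * bandwidth \<beta> n / qn \<beta> z0 n) \<longlonglongrightarrow> 1 / 2"
    and "(\<lambda>n. rate \<beta> n / sqrt (qn \<beta> z0 n)) \<longlonglongrightarrow> 1 / sqrt 2"
    and "filterlim (qn \<beta> z0) at_top sequentially"
proof -
  let ?v = "\<lambda>n. real n * bandwidth \<beta> n"
  note asym = bandwidth_asymptotics[OF assms(1)]
  have "\<forall>\<^sub>F n in sequentially. bandwidth \<beta> n < min z0 (1 - z0)"
    using assms by (intro order_tendstoD(2)[OF asym(1)]) auto
  moreover have "\<forall>\<^sub>F n in sequentially. 1 \<le> ?v n"
    using asym(2) by (simp add: filterlim_at_top)
  ultimately show ev: "\<forall>\<^sub>F n in sequentially. 0 < n \<and> bandwidth \<beta> n < z0 \<and> z0 + bandwidth \<beta> n \<le> 1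
      \<and> 1 \<le> ?v n"
    using eventually_gt_at_top[of 0] by eventually_elim auto
  have inv: "(\<lambda>n. 1 / ?v n) \<longlonglongrightarrow> 0"
    using tendsto_inverse_0_at_top[OF asym(2)] by (simp add: inverse_eq_divide)
  have sandwich: "\<forall>\<^sub>F n in sequentially. 2 - 1 / ?v n \<le> qn \<beta> z0 n / ?v n \<and> qn \<beta> z0 n / ?v n \<le> 2 + 1 / ?v n"
    using ev
  proof eventually_elim
    case (elim n)
    then have v: "0 < ?v n" by linarith
    have "(2 * ?v n - 1) / ?v n \<le> qn \<beta> z0 n / ?v n" "qn \<beta> z0 n / ?v n \<le> (2 * ?v n + 1) / ?v n"
      using qn_bounds[of \<beta> n z0] elim v by (auto intro!: divide_right_mono)
    moreover have "2 - 1 / v = (2 * v - 1) / v" "2 + 1 / v = (2 * v + 1) / v" if "0 < v" for v :: real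
      using that by (simp_all add: field_simps)
    ultimately show ?case
      using v by (simp only: simp_thms)
  qed
  have "(\<lambda>n. 2 - 1 / ?v n) \<longlonglongrightarrow> 2" "(\<lambda>n. 2 + 1 / ?v n) \<longlonglongrightarrow> 2"
    using tendsto_diff[OF tendsto_const inv, of 2] tendsto_add[OF tendsto_const inv, of 2] by auto
  from real_tendsto_sandwich[OF sandwich[THEN eventually_conj_iff[THEN iffD1], THEN conjunct1]
      sandwich[THEN eventually_conj_iff[THEN iffD1], THEN conjunct2] this]
  have "(\<lambda>n. qn \<beta> z0 n / ?v n) \<longlonglongrightarrow> 2" .
  from tendsto_inverse[OF this] show lim: "(\<lambda>n. ?v n / qn \<beta> z0 n) \<longlonglongrightarrow> 1 / 2"
    by (simp add: inverse_eq_divide)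
  have "(\<lambda>n. sqrt (?v n / qn \<beta> z0 n)) \<longlonglongrightarrow> 1 / sqrt 2"
    using tendsto_real_sqrt[OF lim] by (simp add: real_sqrt_divide)
  then show "(\<lambda>n. rate \<beta> n / sqrt (qn \<beta> z0 n)) \<longlonglongrightarrow> 1 / sqrt 2"
    by (rule Lim_transform_eventually)
      (use eventually_gt_at_top[of 0] in eventually_elim, simp add: asym(5) real_sqrt_divide)
  show "filterlim (qn \<beta> z0) at_top sequentially"
  proof (rule filterlim_at_top_mono[OF asym(2)])
    show "\<forall>\<^sub>F n in sequentially. ?v n \<le> qn \<beta> z0 n"
      using ev
    proof eventually_elim
      case (elim n)
      then show ?case using qn_bounds(1)[of \<beta> n z0] by auto
    qed
  qed
qed

section \<open>Passage to the limit\<close>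

theorem theorem4p2:
  fixes z0 \<alpha> \<beta> \<epsilon> L :: real
    and g :: "real \<Rightarrow> (real \<Rightarrow> real) \<Rightarrow> real"
  assumes "0 < z0" "z0 < 1"
    and "0 < \<alpha>" "\<alpha> \<le> 1" "\<beta> = 1 + \<alpha>"
    and "0 < \<epsilon>" "0 < L"
    and "std_normal_density \<in> noise_densities \<epsilon> L"
    and "assumption_A1 \<beta> z0 g"
    and "assumption_A2 g"
    and "assumption_A3 g"
  shows "Limsup (at_right 0)
           (\<lambda>\<delta>. limsup (\<lambda>n. robust_risk \<beta> \<epsilon> L z0 g \<delta> n (kernel_estimator \<beta> z0 n)))
         \<le> ennreal ((\<integral>x. \<bar>x\<bar> \<partial>density lborel std_normal_density) / sqrt 2)"
proof -
  define m where "m = (\<integral>x. \<bar>x\<bar> \<partial>density lborel std_normal_density)"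
  define \<gamma> where "\<gamma> = min \<epsilon> 1"
  have \<gamma>: "0 < \<gamma>" using \<open>0 < \<epsilon>\<close> by (simp add: \<gamma>_def)
  have m0: "0 \<le> m" unfolding m_def by simp
  have \<beta>: "0 < \<beta>" using assms by simp
  obtain l u0 where l: "0 < l" and g0: "\<And>x S. x \<in> {0..1} \<Longrightarrow> S \<in> C1 \<Longrightarrow> l \<le> g x S \<and> g x S \<le> u0"
    using \<open>assumption_A2 g\<close> unfolding assumption_A2_def by blast
  \<comment> \<open>The maximum keeps \<open>u\<close> nonnegative without exhibiting a member of
    \<open>C1\<close>.\<close>
  define u where "u = max u0 1"
  have g: "l \<le> g x S \<and> g x S \<le> u" if "x \<in> {0..1}" "S \<in> C1" for x S
    using g0[OF that] by (auto simp: u_def)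
  \<comment> \<open>\<open>X\<close> majorises the risk for all large \<open>n\<close>. Here
    \<open>\<kappa>\<close> is both the tolerance in (A1) and the smoothing parameter of the
    absolute value. First \<open>n\<close> tends to infinity with \<open>\<kappa>\<close> and
    \<open>\<delta>\<close> fixed, then \<open>\<kappa>\<close> tends to 0, and
    \<open>\<delta>\<close> last.\<close>
  define X where "X \<kappa> \<delta> n = real n * bandwidth \<beta> n / qn \<beta> z0 n * (\<delta> + 5 * inverse \<delta> * (rate \<beta> n / real n)) / l
      + rate \<beta> n / sqrt (qn \<beta> z0 n) * (1 + \<kappa> / l)
        * (m + \<kappa> + (1 / \<kappa> + 3 / \<kappa>\<^sup>2) * (1 + L) * (u / l / sqrt (qn \<beta> z0 n)) powr \<gamma>)" for \<kappa> \<delta> n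
  note asym = bandwidth_asymptotics[OF \<beta>] and qasym = qn_asymptotics[OF \<beta> \<open>0 < z0\<close> \<open>z0 < 1\<close>]
  have risk: "\<forall>\<^sub>F n in sequentially. robust_risk \<beta> \<epsilon> L z0 g \<delta> n (kernel_estimator \<beta> z0 n) \<le> ennreal (X \<kappa> \<delta> n)"
    if \<delta>: "0 < \<delta>" "\<delta> < 1" and \<kappa>: "0 < \<kappa>" for \<delta> \<kappa>
  proof -
    \<comment> \<open>(A1) controls the supremum over the class, so one threshold for
      \<open>n\<close> serves every \<open>S\<close>; the noise bound is already uniform in the
      density.\<close>
    have "(\<lambda>n. SUP S\<in>weak_holder \<beta> z0 \<delta>. ennreal \<bar>empirical_scale \<beta> z0 g n S - g z0 S\<bar>) \<longlonglongrightarrow> 0"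
      using \<open>assumption_A1 \<beta> z0 g\<close> \<delta> by (auto simp: assumption_A1_def empirical_scale_def)
    then have "\<forall>\<^sub>F n in sequentially.
        (SUP S\<in>weak_holder \<beta> z0 \<delta>. ennreal \<bar>empirical_scale \<beta> z0 g n S - g z0 S\<bar>) < ennreal \<kappa>"
      using \<kappa> by (intro order_tendstoD(2)) auto
    then show ?thesis
      using qasym(1)
    proof eventually_elim
      case (elim n)
      then have n: "0 < n" and win: "bandwidth \<beta> n < z0" "z0 + bandwidth \<beta> n \<le> 1"
        "1 \<le> real n * bandwidth \<beta> n" by auto
      have q: "0 < qn \<beta> z0 n" using qn_bounds(1)[OF win] win(3) by linarith
      have r0: "0 \<le> rate \<beta> n" by (simp add: rate_def)
      have loss: "(\<integral>\<^sup>+y. ennreal (rate \<beta> n * (\<bar>kernel_estimator \<beta> z0 n y - S z0\<bar> / g z0 S)) \<partial>obs_law g n p S)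
          \<le> ennreal (X \<kappa> \<delta> n)" if p: "p \<in> noise_densities \<epsilon> L" and S: "S \<in> weak_holder \<beta> z0 \<delta>" for p S
      proof -
        have C1: "S \<in> C1"
          using S by (auto simp: weak_holder_def holder_class_def holder_ball_def)
        have z0: "z0 \<in> {0..1}" using assms by simp
        have gz: "l \<le> g z0 S" using g[OF z0 C1] by simp
        have "ennreal \<bar>empirical_scale \<beta> z0 g n S - g z0 S\<bar> < ennreal \<kappa>"
          by (rule le_less_trans[OF SUP_upper[OF S] elim(1)])
        then have "\<bar>empirical_scale \<beta> z0 g n S - g z0 S\<bar> < \<kappa>"
          by (simp add: ennreal_less_iff)
        then have "empirical_scale \<beta> z0 g n S / g z0 S \<le> (g z0 S + \<kappa>) / g z0 S"
          using gz l by (intro divide_right_mono) auto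
        also have "\<dots> = 1 + \<kappa> / g z0 S"
          using gz l by (simp add: add_divide_distrib)
        also have "\<dots> \<le> 1 + \<kappa> / l"
          using gz l \<kappa> by (intro add_left_mono divide_left_mono) auto
        finally have scale: "empirical_scale \<beta> z0 g n S / g z0 S \<le> 1 + \<kappa> / l" .
        let ?bias = "\<bar>kernel_estimator \<beta> z0 n (\<lambda>k. S (design n k)) - S z0\<bar>"
        have "rate \<beta> n * ?bias \<le> rate \<beta> n * (real n * bandwidth \<beta> n / qn \<beta> z0 n
            * (\<delta> * bandwidth \<beta> n powr \<beta> + 5 * inverse \<delta> / real n))"
          using r0 by (intro mult_left_mono bias_bound[OF S win])
        also have "\<dots> = real n * bandwidth \<beta> n / qn \<beta> z0 n
            * (\<delta> * (rate \<beta> n * bandwidth \<beta> n powr \<beta>) + 5 * inverse \<delta> * (rate \<beta> n / real n))"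
          by (simp add: algebra_simps)
        finally have num: "rate \<beta> n * ?bias \<le> real n * bandwidth \<beta> n / qn \<beta> z0 n
            * (\<delta> + 5 * inverse \<delta> * (rate \<beta> n / real n))"
          by (simp add: asym(4)[OF n])
        have "rate \<beta> n * ?bias / g z0 S \<le> rate \<beta> n * ?bias / l"
          using gz l r0 by (intro divide_left_mono) auto
        also have "\<dots> \<le> real n * bandwidth \<beta> n / qn \<beta> z0 n
            * (\<delta> + 5 * inverse \<delta> * (rate \<beta> n / real n)) / l"
          using l by (intro divide_right_mono num) auto
        finally have bias: "rate \<beta> n * ?bias / g z0 S \<le> real n * bandwidth \<beta> n / qn \<beta> z0 n
            * (\<delta> + 5 * inverse \<delta> * (rate \<beta> n / real n)) / l" .
        have rq: "0 \<le> rate \<beta> n / sqrt (qn \<beta> z0 n)" using r0 q by simp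
        have W0: "0 \<le> m + \<kappa> + (1 / \<kappa> + 3 / \<kappa>\<^sup>2) * (1 + L) * (u / l / sqrt (qn \<beta> z0 n)) powr \<gamma>"
          using \<kappa> \<open>0 < L\<close> m0 by simp
        note integrated_loss_bound[where g=g and S=S and u=u, OF p assms(8) \<open>0 < \<epsilon>\<close> \<open>0 < L\<close> \<kappa> C1 z0 q l g[OF _ C1],
            folded m_def \<gamma>_def]
        also have "ennreal (rate \<beta> n * ?bias / g z0 S
            + rate \<beta> n / sqrt (qn \<beta> z0 n) * (empirical_scale \<beta> z0 g n S / g z0 S)
              * (m + \<kappa> + (1 / \<kappa> + 3 / \<kappa>\<^sup>2) * (1 + L) * (u / l / sqrt (qn \<beta> z0 n)) powr \<gamma>))
            \<le> ennreal (X \<kappa> \<delta> n)"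
          unfolding X_def
          by (intro ennreal_leI add_mono bias mult_right_mono mult_left_mono scale rq W0)
        finally show ?thesis .
      qed
      show ?case
        unfolding robust_risk_def by (intro SUP_least loss)
    qed
  qed
  have X_lim: "X \<kappa> \<delta> \<longlonglongrightarrow> \<delta> / (2 * l) + (1 + \<kappa> / l) * (m + \<kappa>) / sqrt 2" if "0 < \<kappa>" for \<kappa> \<delta>
  proof -
    have "filterlim (\<lambda>n. sqrt (qn \<beta> z0 n)) at_top sequentially"
      by (rule filterlim_compose[OF sqrt_at_top qasym(4)])
    then have "(\<lambda>n. u / l / sqrt (qn \<beta> z0 n)) \<longlonglongrightarrow> 0"
      by (intro tendsto_divide_0[OF tendsto_const] filterlim_at_top_imp_at_infinity)
    \<comment> \<open>At the limit base 0 the convergence rule for \<open>powr\<close> asks for a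
      positive exponent and an eventually nonnegative base.\<close>
    moreover have "\<forall>\<^sub>F n in sequentially. 0 \<le> u / l / sqrt (qn \<beta> z0 n)"
    proof -
      have "\<forall>\<^sub>F n in sequentially. 0 \<le> qn \<beta> z0 n"
        using qasym(4) by (simp add: filterlim_at_top)
      then show ?thesis
        by eventually_elim (use l in \<open>auto simp: u_def\<close>)
    qed
    ultimately have pow: "(\<lambda>n. (u / l / sqrt (qn \<beta> z0 n)) powr \<gamma>) \<longlonglongrightarrow> 0 powr \<gamma>"
      using \<gamma> by (intro tendsto_powr' tendsto_const) auto
    \<comment> \<open>Abstract sequences keep \<open>tendsto_intros\<close> from decomposing
      \<open>qn\<close> and the rate.\<close>
    have "(\<lambda>n. A n * (\<delta> + 5 * inverse \<delta> * R n) / l + B n * (1 + \<kappa> / l) * (m + \<kappa> + c * P n))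
        \<longlonglongrightarrow> 1 / 2 * (\<delta> + 5 * inverse \<delta> * 0) / l + 1 / sqrt 2 * (1 + \<kappa> / l) * (m + \<kappa> + c * 0 powr \<gamma>)"
      if "A \<longlonglongrightarrow> 1 / 2" "R \<longlonglongrightarrow> 0" "B \<longlonglongrightarrow> 1 / sqrt 2" "P \<longlonglongrightarrow> 0 powr \<gamma>"
      for A R B P :: "nat \<Rightarrow> real" and c
      by (intro tendsto_intros that) (use l in auto)
    from this[OF qasym(2) asym(3) qasym(3) pow, of "(1 / \<kappa> + 3 / \<kappa>\<^sup>2) * (1 + L)"]
    have "X \<kappa> \<delta> \<longlonglongrightarrow> 1 / 2 * \<delta> / l + 1 / sqrt 2 * (1 + \<kappa> / l) * (m + \<kappa>)"
      unfolding X_def[abs_def] by (simp only: powr_0 mult_zero_right add_0_right)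
    then show ?thesis by (simp add: mult.commute)
  qed
  \<comment> \<open>The risk does not involve \<open>\<kappa>\<close>, so the bound valid for each
    positive \<open>\<kappa>\<close> survives the limit \<open>\<kappa>\<close> to 0.\<close>
  have limsup_\<delta>: "limsup (\<lambda>n. robust_risk \<beta> \<epsilon> L z0 g \<delta> n (kernel_estimator \<beta> z0 n))
      \<le> ennreal (\<delta> / (2 * l) + m / sqrt 2)" if \<delta>: "0 < \<delta>" "\<delta> < 1" for \<delta>
  proof (rule tendsto_lowerbound)
    have "((\<lambda>\<kappa>. ennreal (\<delta> / (2 * l) + (1 + \<kappa> / l) * (m + \<kappa>) / sqrt 2))
        \<longlongrightarrow> ennreal (\<delta> / (2 * l) + (1 + 0 / l) * (m + 0) / sqrt 2)) (at_right 0)"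
      using l by (intro tendsto_intros) auto
    then show "((\<lambda>\<kappa>. ennreal (\<delta> / (2 * l) + (1 + \<kappa> / l) * (m + \<kappa>) / sqrt 2))
        \<longlongrightarrow> ennreal (\<delta> / (2 * l) + m / sqrt 2)) (at_right 0)"
      by simp
    show "\<forall>\<^sub>F \<kappa> in at_right 0. limsup (\<lambda>n. robust_risk \<beta> \<epsilon> L z0 g \<delta> n (kernel_estimator \<beta> z0 n))
        \<le> ennreal (\<delta> / (2 * l) + (1 + \<kappa> / l) * (m + \<kappa>) / sqrt 2)"
      using eventually_at_right_less[of 0]
    proof eventually_elim
      case (elim \<kappa>)
      have "limsup (\<lambda>n. robust_risk \<beta> \<epsilon> L z0 g \<delta> n (kernel_estimator \<beta> z0 n))
          \<le> limsup (\<lambda>n. ennreal (X \<kappa> \<delta> n))"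
        by (rule Limsup_mono[OF risk[OF \<delta> elim]])
      also have "\<dots> = ennreal (\<delta> / (2 * l) + (1 + \<kappa> / l) * (m + \<kappa>) / sqrt 2)"
        by (intro lim_imp_Limsup tendsto_ennrealI X_lim elim) simp
      finally show ?case .
    qed
  qed simp
  have "Limsup (at_right 0) (\<lambda>\<delta>. limsup (\<lambda>n. robust_risk \<beta> \<epsilon> L z0 g \<delta> n (kernel_estimator \<beta> z0 n)))
      \<le> Limsup (at_right 0) (\<lambda>\<delta>. ennreal (\<delta> / (2 * l) + m / sqrt 2))"
  proof (rule Limsup_mono)
    show "\<forall>\<^sub>F \<delta> in at_right 0. limsup (\<lambda>n. robust_risk \<beta> \<epsilon> L z0 g \<delta> n (kernel_estimator \<beta> z0 n))
        \<le> ennreal (\<delta> / (2 * l) + m / sqrt 2)"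
      \<comment> \<open>The restriction \<open>\<delta> < 1\<close> holds eventually as
        \<open>\<delta>\<close> decreases to 0.\<close>
      using eventually_at_right_real[of 0 1] by (auto elim!: eventually_mono intro: limsup_\<delta>)
  qed
  also have "\<dots> = ennreal (0 / (2 * l) + m / sqrt 2)"
    using l by (intro lim_imp_Limsup tendsto_intros) auto
  finally show ?thesis by (simp add: m_def)
qed

end
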